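(* Let $EDML^n_p=(J^1(T,M),L)$ be the autonomous metrical multi-time Lagrange space of electrodynamics with $L=h^{\alpha\beta}(t)g_{ij}(x)x^i_\alpha x^j_\beta+U^{(\alpha)}_{(i)}(t,x)x^i_\alpha+F(t,x)$, and let $G$ be its gravitational $h$-potential. The Einstein equations $$Ric(C)-\frac{Sc(C)}{2}G=\mathcal K\mathcal T$$ attached to the Cartan canonical connection and to $G$ take, in the adapted frame, the form $$\left\{\begin{array}{l} \displaystyle H_{\alpha\beta}-\frac{H+r}{2}h_{\alpha\beta}=\mathcal K\mathcal T_{\alpha\beta},\\[2mm] \displaystyle r_{ij}-\frac{H+r}{2}g_{ij}=\mathcal K\mathcal T_{ij},\\[2mm] \displaystyle -\frac{H+r}{2}h^{\alpha\beta}g_{ij}=\mathcal K\mathcal T^{(\alpha)(\beta)}_{(i)(j)}, \end{array}\right.$$ $$\left\{\begin{array}{lll} 0=\mathcal T_{\alpha i},&0=\mathcal T_{i\alpha},&0=\mathcal T^{(\alpha)}_{(i)\beta},\\[1mm] 0=\mathcal T^{\;(\beta)}_{\alpha(i)},&0=\mathcal T^{\;(\alpha)}_{i(j)},&0=\mathcal T^{(\alpha)}_{(i)j}, \end{array}\right.$$ where $H_{\alpha\beta}$, $r_{ij}$ are the Ricci tensors and $H=h^{\alpha\beta}H_{\alpha\beta}$, $r=g^{ij}r_{ij}$ the scalar curvatures of the semi-Riemannian metrics $h_{\alpha\beta}$ and $g_{ij}$.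
   Context: Setting. $T$ is a smooth real $p$-dimensional manifold with coordinates $t=(t^\alpha)$, $M$ a smooth real $n$-dimensional manifold with coordinates $x=(x^i)$; $J^1(T,M)$ is the 1-jet bundle with induced coordinates $(t^\alpha,x^i,x^i_\alpha)$. Repeated indices are summed. $h_{\alpha\beta}(t)$ and $g_{ij}(x)$ are semi-Riemannian metrics on $T$ and $M$ with inverses $h^{\alpha\beta}$, $g^{ij}$; $U^{(\alpha)}_{(i)}(t,x)$ are the components of a distinguished tensor (d-tensor) on $J^1(T,M)$, i.e. $U^{(\alpha)}_{(i)}=\frac{\partial t^\alpha}{\partial\tilde t^\beta}\frac{\partial\tilde x^j}{\partial x^i}\tilde U^{(\beta)}_{(j)}$ under changes of coordinates; $F(t,x)$ is a smooth function on $T\times M$. Put $U^{(\alpha)}_{(i)j}=\frac{\partial U^{(\alpha)}_{(i)}}{\partial x^j}-\frac{\partial U^{(\alpha)}_{(j)}}{\partial x^i}$. $H^\gamma_{\alpha\beta}$ and $\gamma^i_{jk}$ are the Christoffel symbols of $h$ and $g$. Canonical nonlinear connection. $\Gamma=(M^{(i)}_{(\alpha)\beta},N^{(i)}_{(\alpha)j})$ with $M^{(i)}_{(\alpha)\beta}=-H^\gamma_{\alpha\beta}x^i_\gamma$ and $N^{(i)}_{(\alpha)j}=\gamma^i_{jk}x^k_\alpha+\frac{h_{\alpha\gamma}g^{il}}{4}U^{(\gamma)}_{(l)j}$. Adapted frame $(X_A)=\left(\frac{\delta}{\delta t^\alpha},\frac{\delta}{\delta x^i},\frac{\partial}{\partial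 x^i_\alpha}\right)$, where $\frac{\delta}{\delta t^\alpha}=\frac{\partial}{\partial t^\alpha}-M^{(j)}_{(\beta)\alpha}\frac{\partial}{\partial x^j_\beta}$, $\frac{\delta}{\delta x^i}=\frac{\partial}{\partial x^i}-N^{(j)}_{(\beta)i}\frac{\partial}{\partial x^j_\beta}$; dual coframe $(dt^\alpha,dx^i,\delta x^i_\alpha)$ with $\delta x^i_\alpha=dx^i_\alpha+M^{(i)}_{(\alpha)\beta}dt^\beta+N^{(i)}_{(\alpha)j}dx^j$. Cartan canonical connection of this space: the linear connection $\nabla$ on $J^1(T,M)$ whose only nonzero covariant derivatives of frame fields are $\nabla_{\delta/\delta t^\gamma}\frac{\delta}{\delta t^\alpha}=H^\beta_{\alpha\gamma}\frac{\delta}{\delta t^\beta}$, $\nabla_{\delta/\delta t^\gamma}\frac{\partial}{\partial x^i_\alpha}=-H^\alpha_{\beta\gamma}\frac{\partial}{\partial x^i_\beta}$, $\nabla_{\delta/\delta x^j}\frac{\delta}{\delta x^i}=\gamma^k_{ij}\frac{\delta}{\delta x^k}$, $\nabla_{\delta/\delta x^j}\frac{\partial}{\partial x^i_\alpha}=\gamma^k_{ij}\frac{\partial}{\partial x^k_\alpha}$ (i.e. $C\Gamma=(H^\gamma_{\alpha\beta},G^k_{j\gamma}=0,L^i_{jk}=\gamma^i_{jk},C^{i(\gamma)}_{j(k)}=0)$). Gravitational $h$-potential: $G=h_{\alpha\beta}dt^\alpha\otimes dt^\beta+g_{ij}dx^i\otimes dx^j+h^{\alpha\beta}g_{ij}\,\delta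 x^i_\alpha\otimes\delta x^j_\beta$, with $(G^{AB})$ the inverse matrix of its components $(G_{AB})$ in the adapted frame. Curvature: $\mathbf R(X,Y)Z=\nabla_X\nabla_YZ-\nabla_Y\nabla_XZ-\nabla_{[X,Y]}Z$, $\mathbf R(X_C,X_B)X_A=R^D_{ABC}X_D$; Ricci d-tensor $Ric(C)$ with components $R_{AB}=Ric(X_A,X_B)=R^D_{ABD}$; scalar curvature $Sc(C)=G^{AB}R_{AB}$. The Ricci tensors of $h$ and $g$ follow the same convention, e.g. $r_{ij}=r^k_{ijk}$ with $r^l_{ijk}=\frac{\partial\gamma^l_{ij}}{\partial x^k}-\frac{\partial\gamma^l_{ik}}{\partial x^j}+\gamma^s_{ij}\gamma^l_{sk}-\gamma^s_{ik}\gamma^l_{sj}$. $\mathcal K$ is the (nonzero) Einstein constant, and $\mathcal T$ is a $(0,2)$ tensor (the stress-energy d-tensor) with components $\mathcal T_{AB}=\mathcal T(X_A,X_B)$ in the adapted frame; an index pair $\begin{smallmatrix}(\alpha)\\(i)\end{smallmatrix}$ refers to the frame vector $\frac{\partial}{\partial x^i_\alpha}$, indices $\alpha,\beta$ to $\frac{\delta}{\delta t^\alpha},\frac{\delta}{\delta t^\beta}$, and $i,j$ to $\frac{\delta}{\delta x^i},\frac{\delta}{\delta x^j}$. *)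

theory Defs
  imports "HOL-Analysis.Analysis"
begin

section \<open>Smooth maps between open sets of Euclidean spaces\<close>

text \<open>Only used for open \<open>S\<close>. In finite dimension, continuity of all iterated directional
  derivatives is the usual notion of class \<open>C\<^sup>k\<close>.\<close>

primrec Ck_on :: "nat \<Rightarrow> 'a::euclidean_space set \<Rightarrow> ('a \<Rightarrow> 'b::real_normed_vector) \<Rightarrow> bool" where
  "Ck_on 0 S f \<longleftrightarrow> continuous_on S f"
| "Ck_on (Suc k) S f \<longleftrightarrow>
     f differentiable_on S \<and> (\<forall>v. Ck_on k S (\<lambda>x. frechet_derivative f (at x) v))"

definition smooth_on :: "'a::euclidean_space set \<Rightarrow> ('a \<Rightarrow> 'b::real_normed_vector) \<Rightarrow> bool" where
  "smooth_on S f \<longleftrightarrow> (\<forall>k. Ck_on k S f)"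

definition pd :: "'k::finite \<Rightarrow> (real^'k \<Rightarrow> real) \<Rightarrow> real^'k \<Rightarrow> real" where
  "pd k f x = frechet_derivative f (at x) (axis k 1)"

section \<open>Smooth manifolds\<close>

text \<open>A chart is a pair of an open domain and a coordinate map; only the values of the map on
  the domain matter. The dimension of the manifold is the cardinality of the index type.\<close>

type_synonym ('m, 'k) chart = "'m set \<times> ('m \<Rightarrow> real^'k)"

abbreviation cdom :: "('m, 'k::finite) chart \<Rightarrow> 'm set" where
  "cdom c \<equiv> fst c"

abbreviation cmap :: "('m, 'k::finite) chart \<Rightarrow> 'm \<Rightarrow> real^'k" where
  "cmap c \<equiv> snd c"

abbreviation cimg :: "('m, 'k::finite) chart \<Rightarrow> (real^'k) set" where
  "cimg c \<equiv> cmap c ` cdom c"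

abbreviation cinv :: "('m, 'k::finite) chart \<Rightarrow> real^'k \<Rightarrow> 'm" where
  "cinv c \<equiv> inv_into (cdom c) (cmap c)"

definition smooth_atlas :: "('m::topological_space, 'k::finite) chart set \<Rightarrow> bool" where
  "smooth_atlas A \<longleftrightarrow>
     (\<Union>c\<in>A. cdom c) = UNIV \<and>
     (\<forall>c\<in>A. open (cdom c) \<and> open (cimg c) \<and> homeomorphism (cdom c) (cimg c) (cmap c) (cinv c)) \<and>
     (\<forall>c\<in>A. \<forall>c'\<in>A. smooth_on (cmap c ` (cdom c \<inter> cdom c')) (cmap c' \<circ> cinv c))"

text \<open>\<open>jac c c' m $ i $ j\<close> is the partial derivative of the \<open>i\<close>-th coordinate of \<open>c'\<close> with respect
  to the \<open>j\<close>-th coordinate of \<open>c\<close>, at the point \<open>m\<close>.\<close>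

definition jac :: "('m, 'k::finite) chart \<Rightarrow> ('m, 'k) chart \<Rightarrow> 'm \<Rightarrow> real^'k^'k" where
  "jac c c' m = matrix (frechet_derivative (cmap c' \<circ> cinv c) (at (cmap c m)))"

section \<open>Semi-Riemannian metrics\<close>

definition metric_index :: "real^'k^'k \<Rightarrow> nat" where
  "metric_index B = Max {dim S | S. subspace S \<and> (\<forall>v\<in>S. v \<noteq> 0 \<longrightarrow> v \<bullet> (B *v v) < 0)}"

text \<open>A metric is given by its matrix of components in every chart of the atlas, as a function of
  the coordinates: smooth, symmetric, nondegenerate, of constant index, with the transformation
  law of a \<open>(0,2)\<close> tensor.\<close>

definition semi_riemannian_metric ::
    "('m, 'k::finite) chart set \<Rightarrow> (('m, 'k) chart \<Rightarrow> real^'k \<Rightarrow> real^'k^'k) \<Rightarrow> bool" where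
  "semi_riemannian_metric A g \<longleftrightarrow>
     (\<forall>c\<in>A. smooth_on (cimg c) (g c)) \<and>
     (\<forall>c\<in>A. \<forall>x\<in>cimg c. transpose (g c x) = g c x \<and> invertible (g c x)) \<and>
     (\<exists>\<nu>. \<forall>c\<in>A. \<forall>x\<in>cimg c. metric_index (g c x) = \<nu>) \<and>
     (\<forall>c\<in>A. \<forall>c'\<in>A. \<forall>m\<in>cdom c \<inter> cdom c'.
        g c (cmap c m) = transpose (jac c c' m) ** g c' (cmap c' m) ** jac c c' m)"

context
  fixes g :: "real^'k \<Rightarrow> real^'k^'k"
begin

text \<open>\<open>christoffel x i j k\<close> is \<open>\<gamma>\<^sup>i\<^sub>j\<^sub>k\<close>, and \<open>riemann x l i j k\<close> is \<open>r\<^sup>l\<^sub>i\<^sub>j\<^sub>k\<close>; the Ricci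
  contraction is over the upper and the last lower index.\<close>

definition christoffel :: "real^'k \<Rightarrow> 'k \<Rightarrow> 'k \<Rightarrow> 'k \<Rightarrow> real" where
  "christoffel x i j k =
     (\<Sum>l\<in>UNIV. matrix_inv (g x) $ i $ l / 2 *
        (pd k (\<lambda>z. g z $ j $ l) x + pd j (\<lambda>z. g z $ k $ l) x - pd l (\<lambda>z. g z $ j $ k) x))"

definition riemann :: "real^'k \<Rightarrow> 'k \<Rightarrow> 'k \<Rightarrow> 'k \<Rightarrow> 'k \<Rightarrow> real" where
  "riemann x l i j k =
     pd k (\<lambda>z. christoffel z l i j) x - pd j (\<lambda>z. christoffel z l i k) x
     + (\<Sum>s\<in>UNIV. christoffel x s i j * christoffel x l s k)
     - (\<Sum>s\<in>UNIV. christoffel x s i k * christoffel x l s j)"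

definition ricci :: "real^'k \<Rightarrow> 'k \<Rightarrow> 'k \<Rightarrow> real" where
  "ricci x i j = (\<Sum>k\<in>UNIV. riemann x k i j k)"

definition scalar_curv :: "real^'k \<Rightarrow> real" where
  "scalar_curv x = (\<Sum>i\<in>UNIV. \<Sum>j\<in>UNIV. matrix_inv (g x) $ i $ j * ricci x i j)"

end

section \<open>The 1-jet bundle and its induced coordinates\<close>

definition smooth_near :: "('t::topological_space, 'p::finite) chart set \<Rightarrow>
    ('m::topological_space, 'n::finite) chart set \<Rightarrow> 't \<Rightarrow> ('t \<Rightarrow> 'm) \<Rightarrow> bool" where
  "smooth_near AT AM t \<phi> \<longleftrightarrow>
     (\<exists>c\<in>AT. \<exists>d\<in>AM. \<exists>N. open N \<and> t \<in> N \<and> N \<subseteq> cdom c \<and> \<phi> ` N \<subseteq> cdom d \<and>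
        smooth_on (cmap c ` N) (cmap d \<circ> \<phi> \<circ> cinv c))"

definition local_deriv :: "('t, 'p::finite) chart \<Rightarrow> ('m, 'n::finite) chart \<Rightarrow> 't \<Rightarrow>
    ('t \<Rightarrow> 'm) \<Rightarrow> real^'p^'n" where
  "local_deriv c d t \<phi> = matrix (frechet_derivative (cmap d \<circ> \<phi> \<circ> cinv c) (at (cmap c t)))"

text \<open>The jet of \<open>\<phi>\<close> at \<open>t\<close> is \<open>t\<close> together with the class of all maps, smooth near \<open>t\<close>, having
  the same value and the same first derivatives at \<open>t\<close>.\<close>

type_synonym ('t, 'm) jet = "'t \<times> ('t \<Rightarrow> 'm) set"

definition jet1 :: "('t::topological_space, 'p::finite) chart set \<Rightarrow>
    ('m::topological_space, 'n::finite) chart set \<Rightarrow> 't \<Rightarrow> ('t \<Rightarrow> 'm) \<Rightarrow> ('t, 'm) jet" where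
  "jet1 AT AM t \<phi> =
     (t, {\<psi>. smooth_near AT AM t \<psi> \<and> \<psi> t = \<phi> t \<and>
             (\<forall>c\<in>AT. \<forall>d\<in>AM. t \<in> cdom c \<and> \<phi> t \<in> cdom d \<longrightarrow>
                 local_deriv c d t \<psi> = local_deriv c d t \<phi>)})"

definition J1 :: "('t::topological_space, 'p::finite) chart set \<Rightarrow>
    ('m::topological_space, 'n::finite) chart set \<Rightarrow> ('t, 'm) jet set" where
  "J1 AT AM = {jet1 AT AM t \<phi> | t \<phi>. smooth_near AT AM t \<phi>}"

definition jet_rep :: "('t, 'm) jet \<Rightarrow> 't \<Rightarrow> 'm" where
  "jet_rep w = (SOME \<phi>. \<phi> \<in> snd w)"

definition jet_source :: "('t, 'm) jet \<Rightarrow> 't" where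
  "jet_source w = fst w"

definition jet_target :: "('t, 'm) jet \<Rightarrow> 'm" where
  "jet_target w = jet_rep w (jet_source w)"

text \<open>Coordinates \<open>(t\<^sup>\<alpha>, x\<^sup>i, x\<^sup>i\<^sub>\<alpha>)\<close> of a jet: \<open>x\<^sup>i\<^sub>\<alpha>\<close> is entry \<open>$ i $ \<alpha>\<close> of the last component.\<close>

type_synonym ('p, 'n) jvec = "(real^'p) \<times> (real^'n) \<times> (real^'p^'n)"

definition jet_dom :: "('t::topological_space, 'p::finite) chart set \<Rightarrow>
    ('m::topological_space, 'n::finite) chart set \<Rightarrow>
    ('t, 'p) chart \<Rightarrow> ('m, 'n) chart \<Rightarrow> ('t, 'm) jet set" where
  "jet_dom AT AM c d = {w \<in> J1 AT AM. jet_source w \<in> cdom c \<and> jet_target w \<in> cdom d}"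

definition jet_coords :: "('t, 'p::finite) chart \<Rightarrow> ('m, 'n::finite) chart \<Rightarrow>
    ('t, 'm) jet \<Rightarrow> ('p, 'n) jvec" where
  "jet_coords c d w = (cmap c (jet_source w), cmap d (jet_target w),
                       local_deriv c d (jet_source w) (jet_rep w))"

section \<open>Metrical multi-time Lagrange spaces of electrodynamics\<close>

text \<open>\<open>U c d t x $ i $ \<alpha>\<close> is \<open>U\<^sup>(\<^sup>\<alpha>\<^sup>)\<^sub>(\<^sub>i\<^sub>)(t,x)\<close> in the coordinates induced by \<open>c\<close> and \<open>d\<close>.\<close>

definition d_tensor_U :: "('t, 'p::finite) chart set \<Rightarrow> ('m, 'n::finite) chart set \<Rightarrow>
    (('t, 'p) chart \<Rightarrow> ('m, 'n) chart \<Rightarrow> real^'p \<Rightarrow> real^'n \<Rightarrow> real^'p^'n) \<Rightarrow> bool" where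
  "d_tensor_U AT AM U \<longleftrightarrow>
     (\<forall>c\<in>AT. \<forall>d\<in>AM. smooth_on (cimg c \<times> cimg d) (\<lambda>(t, x). U c d t x)) \<and>
     (\<forall>c\<in>AT. \<forall>c'\<in>AT. \<forall>d\<in>AM. \<forall>d'\<in>AM. \<forall>t\<in>cdom c \<inter> cdom c'. \<forall>x\<in>cdom d \<inter> cdom d'. \<forall>i \<alpha>.
        U c d (cmap c t) (cmap d x) $ i $ \<alpha> =
          (\<Sum>\<beta>\<in>UNIV. \<Sum>j\<in>UNIV. jac c' c t $ \<alpha> $ \<beta> * jac d d' x $ j $ i *
             U c' d' (cmap c' t) (cmap d' x) $ j $ \<beta>))"

definition smooth_fun_TM :: "('t, 'p::finite) chart set \<Rightarrow> ('m, 'n::finite) chart set \<Rightarrow>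
    ('t \<Rightarrow> 'm \<Rightarrow> real) \<Rightarrow> bool" where
  "smooth_fun_TM AT AM F \<longleftrightarrow>
     (\<forall>c\<in>AT. \<forall>d\<in>AM. smooth_on (cimg c \<times> cimg d) (\<lambda>(t, x). F (cinv c t) (cinv d x)))"

definition edml_space :: "('t::topological_space, 'p::finite) chart set \<Rightarrow>
    ('m::topological_space, 'n::finite) chart set \<Rightarrow>
    (('t, 'p) chart \<Rightarrow> real^'p \<Rightarrow> real^'p^'p) \<Rightarrow>
    (('m, 'n) chart \<Rightarrow> real^'n \<Rightarrow> real^'n^'n) \<Rightarrow>
    (('t, 'p) chart \<Rightarrow> ('m, 'n) chart \<Rightarrow> real^'p \<Rightarrow> real^'n \<Rightarrow> real^'p^'n) \<Rightarrow>
    ('t \<Rightarrow> 'm \<Rightarrow> real) \<Rightarrow> (('t, 'm) jet \<Rightarrow> real) \<Rightarrow> bool" where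
  "edml_space AT AM h g U F L \<longleftrightarrow>
     semi_riemannian_metric AT h \<and> semi_riemannian_metric AM g \<and>
     d_tensor_U AT AM U \<and> smooth_fun_TM AT AM F \<and>
     (\<forall>c\<in>AT. \<forall>d\<in>AM. \<forall>w\<in>jet_dom AT AM c d. \<forall>t x v. jet_coords c d w = (t, x, v) \<longrightarrow>
        L w =
          (\<Sum>\<alpha>\<in>UNIV. \<Sum>\<beta>\<in>UNIV. \<Sum>i\<in>UNIV. \<Sum>j\<in>UNIV.
             matrix_inv (h c t) $ \<alpha> $ \<beta> * g d x $ i $ j * v $ i $ \<alpha> * v $ j $ \<beta>)
          + (\<Sum>\<alpha>\<in>UNIV. \<Sum>i\<in>UNIV. U c d t x $ i $ \<alpha> * v $ i $ \<alpha>)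
          + F (jet_source w) (jet_target w))"

section \<open>Canonical nonlinear connection, adapted frame, gravitational potential\<close>

text \<open>Indices of the adapted frame: \<open>tI \<alpha>\<close> for \<open>\<delta>/\<delta>t\<^sup>\<alpha>\<close>, \<open>xI i\<close> for \<open>\<delta>/\<delta>x\<^sup>i\<close>, and \<open>vI i \<alpha>\<close> for
  \<open>\<partial>/\<partial>x\<^sup>i\<^sub>\<alpha>\<close>.\<close>

type_synonym ('p, 'n) fidx = "'p + ('n + 'n \<times> 'p)"

abbreviation tI :: "'p \<Rightarrow> ('p, 'n) fidx" where
  "tI \<alpha> \<equiv> Inl \<alpha>"

abbreviation xI :: "'n \<Rightarrow> ('p, 'n) fidx" where
  "xI i \<equiv> Inr (Inl i)"

abbreviation vI :: "'n \<Rightarrow> 'p \<Rightarrow> ('p, 'n) fidx" where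
  "vI i \<alpha> \<equiv> Inr (Inr (i, \<alpha>))"

text \<open>From here to the scalar curvature, \<open>h\<close>, \<open>g\<close>, \<open>U\<close> are the component functions in fixed
  charts of \<open>T\<close> and \<open>M\<close>, and \<open>y\<close> is a point in the induced coordinates. In \<open>nlM\<close> and \<open>nlN\<close> the
  index order \<open>i\<close>, \<open>\<alpha>\<close>, \<open>\<beta>\<close> (resp. \<open>j\<close>) is that of \<open>M\<^sup>(\<^sup>i\<^sup>)\<^sub>(\<^sub>\<alpha>\<^sub>)\<^sub>\<beta>\<close> and \<open>N\<^sup>(\<^sup>i\<^sup>)\<^sub>(\<^sub>\<alpha>\<^sub>)\<^sub>j\<close>.\<close>

context
  fixes h :: "real^'p \<Rightarrow> real^'p^'p"
    and g :: "real^'n \<Rightarrow> real^'n^'n"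
    and U :: "real^'p \<Rightarrow> real^'n \<Rightarrow> real^'p^'n"
begin

text \<open>\<open>U_curl t x \<gamma> l j\<close> is \<open>U\<^sup>(\<^sup>\<gamma>\<^sup>)\<^sub>(\<^sub>l\<^sub>)\<^sub>j\<close>.\<close>

definition U_curl :: "real^'p \<Rightarrow> real^'n \<Rightarrow> 'p \<Rightarrow> 'n \<Rightarrow> 'n \<Rightarrow> real" where
  "U_curl t x \<gamma> l j = pd j (\<lambda>z. U t z $ l $ \<gamma>) x - pd l (\<lambda>z. U t z $ j $ \<gamma>) x"

fun nlM :: "('p, 'n) jvec \<Rightarrow> 'n \<Rightarrow> 'p \<Rightarrow> 'p \<Rightarrow> real" where
  "nlM (t, x, v) i \<alpha> \<beta> = - (\<Sum>\<gamma>\<in>UNIV. christoffel h t \<gamma> \<alpha> \<beta> * v $ i $ \<gamma>)"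

fun nlN :: "('p, 'n) jvec \<Rightarrow> 'n \<Rightarrow> 'p \<Rightarrow> 'n \<Rightarrow> real" where
  "nlN (t, x, v) i \<alpha> j =
     (\<Sum>k\<in>UNIV. christoffel g x i j k * v $ k $ \<alpha>)
     + (\<Sum>\<gamma>\<in>UNIV. \<Sum>l\<in>UNIV. h t $ \<alpha> $ \<gamma> * matrix_inv (g x) $ i $ l / 4 * U_curl t x \<gamma> l j)"

fun frame :: "('p, 'n) fidx \<Rightarrow> ('p, 'n) jvec \<Rightarrow> ('p, 'n) jvec" where
  "frame (Inl \<alpha>) y = (axis \<alpha> 1, 0, - (\<chi> j \<beta>. nlM y j \<beta> \<alpha>))"
| "frame (Inr (Inl i)) y = (0, axis i 1, - (\<chi> j \<beta>. nlN y j \<beta> i))"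
| "frame (Inr (Inr (i, \<alpha>))) y = (0, 0, axis i (axis \<alpha> 1))"

fun coframe :: "('p, 'n) fidx \<Rightarrow> ('p, 'n) jvec \<Rightarrow> ('p, 'n) jvec \<Rightarrow> real" where
  "coframe (Inl \<alpha>) y (a, b, e) = a $ \<alpha>"
| "coframe (Inr (Inl i)) y (a, b, e) = b $ i"
| "coframe (Inr (Inr (i, \<alpha>))) y (a, b, e) =
     e $ i $ \<alpha> + (\<Sum>\<beta>\<in>UNIV. nlM y i \<alpha> \<beta> * a $ \<beta>) + (\<Sum>j\<in>UNIV. nlN y i \<alpha> j * b $ j)"

fun grav_potential :: "('p, 'n) jvec \<Rightarrow> ('p, 'n) jvec \<Rightarrow> ('p, 'n) jvec \<Rightarrow> real" where
  "grav_potential (t, x, v) X Y =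
     (\<Sum>\<alpha>\<in>UNIV. \<Sum>\<beta>\<in>UNIV.
        h t $ \<alpha> $ \<beta> * coframe (tI \<alpha>) (t, x, v) X * coframe (tI \<beta>) (t, x, v) Y)
     + (\<Sum>i\<in>UNIV. \<Sum>j\<in>UNIV.
        g x $ i $ j * coframe (xI i) (t, x, v) X * coframe (xI j) (t, x, v) Y)
     + (\<Sum>\<alpha>\<in>UNIV. \<Sum>\<beta>\<in>UNIV. \<Sum>i\<in>UNIV. \<Sum>j\<in>UNIV.
        matrix_inv (h t) $ \<alpha> $ \<beta> * g x $ i $ j
          * coframe (vI i \<alpha>) (t, x, v) X * coframe (vI j \<beta>) (t, x, v) Y)"

definition G_mat :: "('p, 'n) jvec \<Rightarrow> real^(('p, 'n) fidx)^(('p, 'n) fidx)" where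
  "G_mat y = (\<chi> A B. grav_potential y (frame A y) (frame B y))"

end

section \<open>Linear connections and their curvature\<close>

text \<open>Vector fields on an open coordinate domain \<open>W\<close> are functions into the coordinate space; only
  their values on \<open>W\<close> matter.\<close>

definition lie_bracket :: "('a::euclidean_space \<Rightarrow> 'a) \<Rightarrow> ('a \<Rightarrow> 'a) \<Rightarrow> 'a \<Rightarrow> 'a" where
  "lie_bracket X Y y =
     frechet_derivative Y (at y) (X y) - frechet_derivative X (at y) (Y y)"

type_synonym 'a connection = "('a \<Rightarrow> 'a) \<Rightarrow> ('a \<Rightarrow> 'a) \<Rightarrow> 'a \<Rightarrow> 'a"

definition linear_connection_on :: "'a::euclidean_space set \<Rightarrow> 'a connection \<Rightarrow> bool" where
  "linear_connection_on W D \<longleftrightarrow>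
     (\<forall>X Y. smooth_on W X \<and> smooth_on W Y \<longrightarrow> smooth_on W (D X Y)) \<and>
     (\<forall>X X' Y. smooth_on W X \<and> smooth_on W X' \<and> smooth_on W Y \<longrightarrow>
        (\<forall>y\<in>W. D (\<lambda>z. X z + X' z) Y y = D X Y y + D X' Y y)) \<and>
     (\<forall>f X Y. smooth_on W (f :: 'a \<Rightarrow> real) \<and> smooth_on W X \<and> smooth_on W Y \<longrightarrow>
        (\<forall>y\<in>W. D (\<lambda>z. f z *\<^sub>R X z) Y y = f y *\<^sub>R D X Y y)) \<and>
     (\<forall>X Y Y'. smooth_on W X \<and> smooth_on W Y \<and> smooth_on W Y' \<longrightarrow>
        (\<forall>y\<in>W. D X (\<lambda>z. Y z + Y' z) y = D X Y y + D X Y' y)) \<and>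
     (\<forall>f X Y. smooth_on W (f :: 'a \<Rightarrow> real) \<and> smooth_on W X \<and> smooth_on W Y \<longrightarrow>
        (\<forall>y\<in>W. D X (\<lambda>z. f z *\<^sub>R Y z) y =
           frechet_derivative f (at y) (X y) *\<^sub>R Y y + f y *\<^sub>R D X Y y))"

definition curvature :: "'a::euclidean_space connection \<Rightarrow>
    ('a \<Rightarrow> 'a) \<Rightarrow> ('a \<Rightarrow> 'a) \<Rightarrow> ('a \<Rightarrow> 'a) \<Rightarrow> 'a \<Rightarrow> 'a" where
  "curvature D X Y Z y = D X (D Y Z) y - D Y (D X Z) y - D (lie_bracket X Y) Z y"

context
  fixes h :: "real^'p \<Rightarrow> real^'p^'p"
    and g :: "real^'n \<Rightarrow> real^'n^'n"
    and U :: "real^'p \<Rightarrow> real^'n \<Rightarrow> real^'p^'n"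
begin

abbreviation (input) "fr \<equiv> frame h g U"

definition cartan_connection_on ::
    "('p, 'n) jvec set \<Rightarrow> ('p, 'n) jvec connection \<Rightarrow> bool" where
  "cartan_connection_on W D \<longleftrightarrow>
     linear_connection_on W D \<and>
     (\<forall>t x v. (t, x, v) \<in> W \<longrightarrow>
       (\<forall>\<gamma> \<alpha>. D (fr (tI \<gamma>)) (fr (tI \<alpha>)) (t, x, v) =
          (\<Sum>\<beta>\<in>UNIV. christoffel h t \<beta> \<alpha> \<gamma> *\<^sub>R fr (tI \<beta>) (t, x, v))) \<and>
       (\<forall>\<gamma> i. D (fr (tI \<gamma>)) (fr (xI i)) (t, x, v) = 0) \<and>
       (\<forall>\<gamma> i \<alpha>. D (fr (tI \<gamma>)) (fr (vI i \<alpha>)) (t, x, v) =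
          - (\<Sum>\<beta>\<in>UNIV. christoffel h t \<alpha> \<beta> \<gamma> *\<^sub>R fr (vI i \<beta>) (t, x, v))) \<and>
       (\<forall>j \<alpha>. D (fr (xI j)) (fr (tI \<alpha>)) (t, x, v) = 0) \<and>
       (\<forall>j i. D (fr (xI j)) (fr (xI i)) (t, x, v) =
          (\<Sum>k\<in>UNIV. christoffel g x k i j *\<^sub>R fr (xI k) (t, x, v))) \<and>
       (\<forall>j i \<alpha>. D (fr (xI j)) (fr (vI i \<alpha>)) (t, x, v) =
          (\<Sum>k\<in>UNIV. christoffel g x k i j *\<^sub>R fr (vI k \<alpha>) (t, x, v))) \<and>
       (\<forall>j \<beta> A. D (fr (vI j \<beta>)) (fr A) (t, x, v) = 0))"

text \<open>\<open>curv_comp D y E A B C\<close> is \<open>R\<^sup>E\<^sub>A\<^sub>B\<^sub>C\<close>; note the order of the arguments in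
  \<open>R(X\<^sub>C, X\<^sub>B) X\<^sub>A\<close>.\<close>

definition curv_comp :: "('p, 'n) jvec connection \<Rightarrow> ('p, 'n) jvec \<Rightarrow>
    ('p, 'n) fidx \<Rightarrow> ('p, 'n) fidx \<Rightarrow> ('p, 'n) fidx \<Rightarrow> ('p, 'n) fidx \<Rightarrow> real" where
  "curv_comp D y E A B C = coframe h g U E y (curvature D (fr C) (fr B) (fr A) y)"

definition ric_comp :: "('p, 'n) jvec connection \<Rightarrow> ('p, 'n) jvec \<Rightarrow>
    ('p, 'n) fidx \<Rightarrow> ('p, 'n) fidx \<Rightarrow> real" where
  "ric_comp D y A B = (\<Sum>E\<in>UNIV. curv_comp D y E A B E)"

definition ric_tensor :: "('p, 'n) jvec connection \<Rightarrow> ('p, 'n) jvec \<Rightarrow>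
    ('p, 'n) jvec \<Rightarrow> ('p, 'n) jvec \<Rightarrow> real" where
  "ric_tensor D y X Y =
     (\<Sum>A\<in>UNIV. \<Sum>B\<in>UNIV. ric_comp D y A B * coframe h g U A y X * coframe h g U B y Y)"

definition sc_curv :: "('p, 'n) jvec connection \<Rightarrow> ('p, 'n) jvec \<Rightarrow> real" where
  "sc_curv D y =
     (\<Sum>A\<in>UNIV. \<Sum>B\<in>UNIV. matrix_inv (G_mat h g U y) $ A $ B * ric_comp D y A B)"

end

section \<open>Global objects on the jet bundle\<close>

text \<open>A connection on the jet bundle is given by its restrictions to the domains of the induced
  charts. Frame values and Leibniz rule determine each restriction, and the adapted frames of two
  charts are related by the tensorial rule, so compatibility on overlaps need not be assumed.\<close>

definition cartan_connection :: "('t::topological_space, 'p::finite) chart set \<Rightarrow>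
    ('m::topological_space, 'n::finite) chart set \<Rightarrow>
    (('t, 'p) chart \<Rightarrow> real^'p \<Rightarrow> real^'p^'p) \<Rightarrow>
    (('m, 'n) chart \<Rightarrow> real^'n \<Rightarrow> real^'n^'n) \<Rightarrow>
    (('t, 'p) chart \<Rightarrow> ('m, 'n) chart \<Rightarrow> real^'p \<Rightarrow> real^'n \<Rightarrow> real^'p^'n) \<Rightarrow>
    (('t, 'p) chart \<Rightarrow> ('m, 'n) chart \<Rightarrow> ('p, 'n) jvec connection) \<Rightarrow> bool" where
  "cartan_connection AT AM h g U D \<longleftrightarrow>
     (\<forall>c\<in>AT. \<forall>d\<in>AM.
        cartan_connection_on (h c) (g d) (U c d) (jet_coords c d ` jet_dom AT AM c d) (D c d))"

text \<open>A \<open>(0,2)\<close> tensor on the jet bundle: \<open>\<T> c d y\<close> is the bilinear form, in the coordinates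
  induced by \<open>c\<close> and \<open>d\<close>, at the point with coordinates \<open>y\<close>.\<close>

definition jet_tensor2 :: "('t::topological_space, 'p::finite) chart set \<Rightarrow>
    ('m::topological_space, 'n::finite) chart set \<Rightarrow>
    (('t, 'p) chart \<Rightarrow> ('m, 'n) chart \<Rightarrow> ('p, 'n) jvec \<Rightarrow>
       ('p, 'n) jvec \<Rightarrow> ('p, 'n) jvec \<Rightarrow> real) \<Rightarrow> bool" where
  "jet_tensor2 AT AM \<T> \<longleftrightarrow>
     (\<forall>c\<in>AT. \<forall>d\<in>AM. \<forall>w\<in>jet_dom AT AM c d. bilinear (\<T> c d (jet_coords c d w))) \<and>
     (\<forall>c\<in>AT. \<forall>c'\<in>AT. \<forall>d\<in>AM. \<forall>d'\<in>AM. \<forall>w\<in>jet_dom AT AM c d \<inter> jet_dom AT AM c' d'.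
        let J = frechet_derivative
                  (jet_coords c' d' \<circ> inv_into (jet_dom AT AM c d) (jet_coords c d))
                  (at (jet_coords c d w))
        in \<forall>X Y. \<T> c d (jet_coords c d w) X Y = \<T> c' d' (jet_coords c' d' w) (J X) (J Y))"

end

theory Submission
  imports Defs
begin

text \<open>All brackets of adapted frame fields are vertical, and vertical covariant derivatives of the
  frame vanish, so the bracket term drops out of the curvature in the frame. What remains is
  algebraic in the connection coefficients and their derivatives. These coefficients respect the
  splitting into temporal, spatial and vertical parts and depend only on \<open>(t, x)\<close>; the contraction
  therefore leaves the Ricci tensor of \<open>h\<close>, that of \<open>g\<close>, and nothing on the vertical part, so that
  the scalar curvature is \<open>H + r\<close>. The Einstein equations are equations of bilinear forms and may
  be compared on the frame. The axioms of a linear connection only speak about smooth fields on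
  the chart domain, hence the closure properties of smooth maps and the proof that the domain is
  open.\<close>

section \<open>Calculus of smooth maps\<close>

lemma frechet_derivative_cong_open:
  assumes "open S" "x \<in> S" "\<And>y. y \<in> S \<Longrightarrow> f y = g y"
  shows "frechet_derivative f (at x) = frechet_derivative g (at x)"
proof -
  have "(f has_derivative f') (at x) \<longleftrightarrow> (g has_derivative f') (at x)" for f'
    using has_derivative_transform_within_open[OF _ assms(1,2)] assms(3) by metis
  then show ?thesis
    unfolding frechet_derivative_def by simp
qed

lemma frechet_derivative_eqI:
  "(f has_derivative f') (at x) \<Longrightarrow> frechet_derivative f (at x) = f'"
  using frechet_derivative_at by metis

text \<open>As \<open>S\<close> is open, derivatives at its points see only values on
  \<open>S\<close>. This makes arbitrary values outside a chart domain harmless.\<close>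

lemma Ck_on_cong:
  assumes "open S" "\<And>x. x \<in> S \<Longrightarrow> f x = g x" "Ck_on k S f"
  shows "Ck_on k S g"
  using assms(2,3)
proof (induction k arbitrary: f g)
  case 0
  then show ?case using continuous_on_cong by fastforce
next
  case (Suc k)
  have "f differentiable_on S"
    using Suc.prems(2) by simp
  then have "g differentiable_on S"
    unfolding differentiable_on_def differentiable_def
    by (metis Suc.prems(1) has_derivative_transform[of _ S g f])
  moreover have "Ck_on k S (\<lambda>x. frechet_derivative g (at x) v)" for v
    by (rule Suc.IH[of "\<lambda>x. frechet_derivative f (at x) v"])
      (use Suc.prems frechet_derivative_cong_open[OF assms(1) _ Suc.prems(1)] in auto)
  ultimately show ?case by simp
qed

text \<open>Replaces \<open>frechet_derivative\<close> by a derivative in closed form, so that each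
  closure proof below reduces to a differentiation rule and an induction on its right-hand
  side.\<close>

lemma Ck_on_SucI:
  assumes "open S" "\<And>x. x \<in> S \<Longrightarrow> (f has_derivative f' x) (at x)"
    and "\<And>v. Ck_on k S (\<lambda>x. f' x v)"
  shows "Ck_on (Suc k) S f"
proof -
  have "f differentiable_on S"
    using assms(2) by (auto simp: differentiable_on_eq_differentiable_at[OF assms(1)] differentiable_def)
  moreover have "Ck_on k S (\<lambda>x. frechet_derivative f (at x) v)" for v
    by (rule Ck_on_cong[OF assms(1) _ assms(3)[of v]]) (simp add: frechet_derivative_eqI[OF assms(2)])
  ultimately show ?thesis by simp
qed

lemma Ck_on_Suc_has_derivative:
  assumes "open S" "Ck_on (Suc k) S f" "x \<in> S"
  shows "(f has_derivative frechet_derivative f (at x)) (at x)"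
  using assms by (simp add: differentiable_on_eq_differentiable_at frechet_derivative_works)

lemma Ck_on_SucD: "Ck_on (Suc k) S f \<Longrightarrow> Ck_on k S f"
proof (induction k arbitrary: f)
  case 0
  then show ?case by (simp add: differentiable_imp_continuous_on)
next
  case (Suc k)
  have "f differentiable_on S" "Ck_on k S (\<lambda>x. frechet_derivative f (at x) v)" for v
    using Suc.prems by (simp, intro Suc.IH) simp
  then show ?case by simp
qed

lemma Ck_on_const: "Ck_on k S (\<lambda>x. c)"
proof (induction k arbitrary: c)
  case 0
  then show ?case by simp
next
  case (Suc k)
  then show ?case by (simp add: frechet_derivative_const)
qed

lemma Ck_on_id:
  assumes "open S"
  shows "Ck_on k S (\<lambda>x. x)"
proof (cases k)
  case 0
  then show ?thesis by (simp add: continuous_on_id)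
next
  case (Suc l)
  show ?thesis unfolding Suc
    by (rule Ck_on_SucI[OF assms, where f' = "\<lambda>x v. v"])
      (auto intro: has_derivative_ident Ck_on_const assms)
qed

lemma Ck_on_bounded_linear:
  assumes "open S" "bounded_linear L" "Ck_on k S f"
  shows "Ck_on k S (\<lambda>x. L (f x))"
  using assms(3)
proof (induction k arbitrary: f)
  case 0
  then show ?case
    using bounded_linear.continuous_on[OF assms(2)] by simp
next
  case (Suc k)
  show ?case
    by (rule Ck_on_SucI[OF assms(1), where f' = "\<lambda>x v. L (frechet_derivative f (at x) v)"])
      (use Suc in \<open>auto intro!: bounded_linear.has_derivative[OF assms(2)]
          Ck_on_Suc_has_derivative[OF assms(1)]\<close>)
qed

text \<open>Meant for the coordinate projections. The derivative of \<open>f (P x)\<close> along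
  \<open>v\<close> is the derivative of \<open>f\<close> along the fixed vector \<open>P v\<close>,
  again composed with \<open>P\<close>, so the induction over arbitrary \<open>f\<close>
  closes.\<close>

lemma Ck_on_compose_bounded_linear:
  assumes "open S" "open R" "bounded_linear P" "P ` R \<subseteq> S" "Ck_on k S f"
  shows "Ck_on k R (\<lambda>x. f (P x))"
  using assms(5)
proof (induction k arbitrary: f)
  case 0
  have "continuous_on R P"
    by (simp add: assms(3) linear_continuous_on)
  then show ?case
    using continuous_on_compose2[OF _ _ assms(4), of f] 0 by simp
next
  case (Suc k)
  have D: "((\<lambda>x. f (P x)) has_derivative (\<lambda>v. frechet_derivative f (at (P x)) (P v))) (at x)"
    if "x \<in> R" for x
    using has_derivative_compose[OF bounded_linear_imp_has_derivative[OF assms(3)]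
        Ck_on_Suc_has_derivative[OF assms(1) Suc.prems]] that assms(4) by blast
  show ?case
    using Suc.prems by (intro Ck_on_SucI[OF assms(2) D] Suc.IH) simp_all
qed

lemma Ck_on_add:
  assumes "open S" "Ck_on k S f" "Ck_on k S g"
  shows "Ck_on k S (\<lambda>x. f x + g x)"
  using assms(2,3)
proof (induction k arbitrary: f g)
  case 0
  then show ?case by (simp add: continuous_on_add)
next
  case (Suc k)
  show ?case
    by (rule Ck_on_SucI[OF assms(1), where
          f' = "\<lambda>x v. frechet_derivative f (at x) v + frechet_derivative g (at x) v"])
      (use Suc in \<open>auto intro!: has_derivative_add Ck_on_Suc_has_derivative[OF assms(1)]\<close>)
qed

text \<open>In each term of the product rule one factor is differentiated and the other is weakened
  by one order, so the induction hypothesis applies to both. Covers products of functions and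
  multiples of vector fields.\<close>

lemma Ck_on_bounded_bilinear:
  assumes "open S" "bounded_bilinear b" "Ck_on k S f" "Ck_on k S g"
  shows "Ck_on k S (\<lambda>x. b (f x) (g x))"
  using assms(3,4)
proof (induction k arbitrary: f g)
  case 0
  then show ?case using bounded_bilinear.continuous_on[OF assms(2)] by simp
next
  case (Suc k)
  show ?case
  proof (rule Ck_on_SucI[OF assms(1), where
        f' = "\<lambda>x v. b (f x) (frechet_derivative g (at x) v) + b (frechet_derivative f (at x) v) (g x)"])
    show "Ck_on k S (\<lambda>x. b (f x) (frechet_derivative g (at x) v)
        + b (frechet_derivative f (at x) v) (g x))" for v
      using Suc.prems by (intro Ck_on_add assms(1) Suc.IH Ck_on_SucD[of k S f] Ck_on_SucD[of k S g]) auto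
  qed (use Suc in \<open>auto intro!: bounded_bilinear.FDERIV[OF assms(2)]
        Ck_on_Suc_has_derivative[OF assms(1)]\<close>)
qed

text \<open>The derivative of \<open>1/f\<close> involves only the derivative of \<open>f\<close>
  and \<open>1/f\<close> itself, the latter at one order lower, which the induction
  supplies.\<close>

lemma Ck_on_inverse:
  fixes f :: "'a::euclidean_space \<Rightarrow> real"
  assumes "open S" "\<And>x. x \<in> S \<Longrightarrow> f x \<noteq> 0" "Ck_on k S f"
  shows "Ck_on k S (\<lambda>x. inverse (f x))"
  using assms(3)
proof (induction k)
  case 0
  then show ?case using assms(2) by (simp add: continuous_on_inverse)
next
  case (Suc k)
  note mult = Ck_on_bounded_bilinear[OF assms(1) bounded_bilinear_mult]
  have "Ck_on k S (\<lambda>x. inverse (f x))"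
    using Suc Ck_on_SucD by blast
  then have "Ck_on k S (\<lambda>x. inverse (f x) * frechet_derivative f (at x) v * inverse (f x))" for v
    using Suc.prems by (intro mult) auto
  then have der: "Ck_on k S (\<lambda>x. - (inverse (f x) * frechet_derivative f (at x) v * inverse (f x)))" for v
    using Ck_on_bounded_linear[OF assms(1) bounded_linear_minus[OF bounded_linear_ident]] by fastforce
  show ?case
    by (rule Ck_on_SucI[OF assms(1) Deriv.has_derivative_inverse der])
      (use assms(2) in \<open>auto intro: Ck_on_Suc_has_derivative[OF assms(1) Suc.prems]\<close>)
qed

section \<open>Closure properties of smooth maps\<close>

lemma smooth_on_cong:
  "open S \<Longrightarrow> (\<And>x. x \<in> S \<Longrightarrow> f x = g x) \<Longrightarrow> smooth_on S f \<Longrightarrow> smooth_on S g"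
  unfolding smooth_on_def using Ck_on_cong by blast

lemma smooth_on_has_derivative:
  "open S \<Longrightarrow> smooth_on S f \<Longrightarrow> x \<in> S \<Longrightarrow>
    (f has_derivative frechet_derivative f (at x)) (at x)"
  unfolding smooth_on_def using Ck_on_Suc_has_derivative by blast

lemma smooth_on_frechet_derivative:
  "smooth_on S f \<Longrightarrow> smooth_on S (\<lambda>x. frechet_derivative f (at x) v)"
  unfolding smooth_on_def by (metis Ck_on.simps(2))

lemma smooth_on_const: "smooth_on S (\<lambda>x. c)"
  by (simp add: smooth_on_def Ck_on_const)

lemma smooth_on_id: "open S \<Longrightarrow> smooth_on S (\<lambda>x. x)"
  by (simp add: smooth_on_def Ck_on_id)

lemma smooth_on_bounded_linear:
  "open S \<Longrightarrow> bounded_linear L \<Longrightarrow> smooth_on S f \<Longrightarrow> smooth_on S (\<lambda>x. L (f x))"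
  by (simp add: smooth_on_def Ck_on_bounded_linear)

lemma smooth_on_compose_bounded_linear:
  "open S \<Longrightarrow> open R \<Longrightarrow> bounded_linear P \<Longrightarrow> P ` R \<subseteq> S \<Longrightarrow> smooth_on S f \<Longrightarrow>
    smooth_on R (\<lambda>x. f (P x))"
  unfolding smooth_on_def using Ck_on_compose_bounded_linear by blast

lemma smooth_on_add:
  "open S \<Longrightarrow> smooth_on S f \<Longrightarrow> smooth_on S g \<Longrightarrow> smooth_on S (\<lambda>x. f x + g x)"
  by (simp add: smooth_on_def Ck_on_add)

lemma smooth_on_minus:
  "open S \<Longrightarrow> smooth_on S f \<Longrightarrow> smooth_on S (\<lambda>x. - f x)"
  using smooth_on_bounded_linear[OF _ bounded_linear_minus[OF bounded_linear_ident]] by blast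

lemma smooth_on_diff:
  "open S \<Longrightarrow> smooth_on S f \<Longrightarrow> smooth_on S g \<Longrightarrow> smooth_on S (\<lambda>x. f x - g x)"
  using smooth_on_add[OF _ _ smooth_on_minus, of S f g] by simp

lemma smooth_on_scaleR:
  "open S \<Longrightarrow> smooth_on S f \<Longrightarrow> smooth_on S g \<Longrightarrow> smooth_on S (\<lambda>x. f x *\<^sub>R g x)"
  by (simp add: smooth_on_def Ck_on_bounded_bilinear[OF _ bounded_bilinear_scaleR])

lemma smooth_on_mult:
  fixes f g :: "'a::euclidean_space \<Rightarrow> real"
  shows "open S \<Longrightarrow> smooth_on S f \<Longrightarrow> smooth_on S g \<Longrightarrow> smooth_on S (\<lambda>x. f x * g x)"
  by (simp add: smooth_on_def Ck_on_bounded_bilinear[OF _ bounded_bilinear_mult])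

lemma smooth_on_inverse:
  fixes f :: "'a::euclidean_space \<Rightarrow> real"
  shows "open S \<Longrightarrow> smooth_on S f \<Longrightarrow> (\<And>x. x \<in> S \<Longrightarrow> f x \<noteq> 0) \<Longrightarrow> smooth_on S (\<lambda>x. inverse (f x))"
  by (simp add: smooth_on_def Ck_on_inverse)

lemma smooth_on_divide:
  fixes f g :: "'a::euclidean_space \<Rightarrow> real"
  shows "open S \<Longrightarrow> smooth_on S f \<Longrightarrow> smooth_on S g \<Longrightarrow> (\<And>x. x \<in> S \<Longrightarrow> g x \<noteq> 0) \<Longrightarrow>
    smooth_on S (\<lambda>x. f x / g x)"
  unfolding divide_inverse by (intro smooth_on_mult smooth_on_inverse)

lemma smooth_on_sum:
  assumes "open S" "\<And>i. i \<in> I \<Longrightarrow> smooth_on S (f i)"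
  shows "smooth_on S (\<lambda>x. \<Sum>i\<in>I. f i x)"
  using assms(2) by (induction I rule: infinite_finite_induct)
    (simp_all add: smooth_on_const smooth_on_add assms(1))

lemma smooth_on_prod:
  fixes f :: "'i \<Rightarrow> 'a::euclidean_space \<Rightarrow> real"
  assumes "open S" "\<And>i. i \<in> I \<Longrightarrow> smooth_on S (f i)"
  shows "smooth_on S (\<lambda>x. \<Prod>i\<in>I. f i x)"
  using assms(2) by (induction I rule: infinite_finite_induct)
    (simp_all add: smooth_on_const smooth_on_mult assms(1))

lemma smooth_on_matrix_nth:
  fixes f :: "'a::euclidean_space \<Rightarrow> real^'k^'l"
  assumes "open S" "smooth_on S f"
  shows "smooth_on S (\<lambda>x. f x $ i $ j)"
  by (intro smooth_on_bounded_linear[OF assms(1) _ assms(2)]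
      bounded_linear_compose[OF bounded_linear_vec_nth bounded_linear_vec_nth])

lemma smooth_on_pd:
  assumes "smooth_on S f"
  shows "smooth_on S (pd k f)"
  unfolding pd_def using smooth_on_frechet_derivative[OF assms] by (simp add: pd_def[abs_def])

lemma smooth_on_det:
  fixes A :: "'a::euclidean_space \<Rightarrow> real^'k^'k"
  assumes "open S" "\<And>i j. smooth_on S (\<lambda>x. A x $ i $ j)"
  shows "smooth_on S (\<lambda>x. det (A x))"
  unfolding det_def
  by (intro smooth_on_sum smooth_on_mult smooth_on_prod smooth_on_const assms)

section \<open>Inverse matrices and smoothness of Christoffel symbols\<close>

lemma matrix_mul_matrix_inv:
  "invertible A \<Longrightarrow> A ** matrix_inv A = mat 1" "invertible A \<Longrightarrow> matrix_inv A ** A = mat 1"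
  unfolding invertible_def matrix_inv_def by (metis (mono_tags, lifting) someI_ex)+

lemma matrix_inv_eqI:
  fixes A B :: "real^'k^'k"
  assumes "A ** B = mat 1"
  shows "matrix_inv A = B"
proof -
  have "B ** A = mat 1"
    using assms matrix_left_right_inverse by blast
  then have "invertible A"
    using assms invertible_def by blast
  then have "matrix_inv A = (matrix_inv A ** A) ** B"
    by (metis assms matrix_mul_assoc matrix_mul_rid)
  then show ?thesis
    by (simp add: matrix_mul_matrix_inv[OF \<open>invertible A\<close>])
qed

text \<open>Column \<open>l\<close> of the inverse solves the linear system with right-hand side
  \<open>axis l 1\<close>. Cramer's rule makes each entry a quotient of polynomials in the entries
  of \<open>A\<close>, whence the smoothness of the inverse metric.\<close>

lemma matrix_inv_cramer:
  fixes A :: "real^'k^'k"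
  assumes "invertible A"
  shows "matrix_inv A $ k $ l
    = det (\<chi> i j. if j = k then axis l 1 $ i else A $ i $ j) / det A"
proof -
  have "det A \<noteq> 0"
    using assms invertible_det_nz by blast
  moreover have "A *v (matrix_inv A *v axis l 1) = axis l 1"
    by (simp add: matrix_vector_mul_assoc matrix_mul_matrix_inv(1)[OF assms])
  ultimately have "matrix_inv A *v axis l 1
      = (\<chi> k. det (\<chi> i j. if j = k then axis l 1 $ i else A $ i $ j) / det A)"
    using cramer by blast
  then have "(matrix_inv A *v axis l 1) $ k
      = det (\<chi> i j. if j = k then axis l 1 $ i else A $ i $ j) / det A" by simp
  then show ?thesis
    by (simp add: matrix_vector_mul_component axis_def inner_vec_def if_distrib cong: if_cong)
qed

lemma smooth_on_matrix_inv:
  fixes A :: "'a::euclidean_space \<Rightarrow> real^'k^'k"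
  assumes "open S" "smooth_on S A" "\<And>x. x \<in> S \<Longrightarrow> invertible (A x)"
  shows "smooth_on S (\<lambda>x. matrix_inv (A x) $ k $ l)"
proof (rule smooth_on_cong[OF assms(1)])
  show "smooth_on S (\<lambda>x. det (\<chi> i j. if j = k then axis l 1 $ i else A x $ i $ j) / det (A x))"
  proof (intro smooth_on_divide smooth_on_det assms(1))
    show "smooth_on S (\<lambda>x. (\<chi> i j. if j = k then axis l 1 $ i else A x $ i $ j) $ i $ j)" for i j
      by (cases "j = k") (simp_all add: smooth_on_const smooth_on_matrix_nth[OF assms(1,2)])
    show "det (A x) \<noteq> 0" if "x \<in> S" for x
      using assms(3)[OF that] invertible_det_nz by blast
  qed (rule smooth_on_matrix_nth[OF assms(1,2)])
qed (simp add: matrix_inv_cramer[OF assms(3)])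

lemma smooth_on_christoffel:
  assumes "open S" "smooth_on S g" "\<And>x. x \<in> S \<Longrightarrow> invertible (g x)"
  shows "smooth_on S (\<lambda>x. christoffel g x i j k)"
  unfolding christoffel_def
  by (intro smooth_on_sum smooth_on_mult smooth_on_divide smooth_on_add smooth_on_diff smooth_on_pd
      smooth_on_matrix_nth smooth_on_matrix_inv smooth_on_const assms) simp_all

text \<open>The direction varies with the point, whereas \<open>smooth_on\<close> controls
  derivatives in fixed directions. Expanding \<open>X y\<close> in the standard basis reduces the
  one to the other.\<close>

lemma smooth_on_frechet_derivative_field:
  assumes "open S" "smooth_on S X" "smooth_on S Y"
  shows "smooth_on S (\<lambda>y. frechet_derivative Y (at y) (X y))"
proof (rule smooth_on_cong[OF assms(1)])
  show "smooth_on S (\<lambda>y. \<Sum>b\<in>Basis. (X y \<bullet> b) *\<^sub>R frechet_derivative Y (at y) b)"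
    by (intro smooth_on_sum smooth_on_scaleR smooth_on_frechet_derivative assms
        smooth_on_bounded_linear[OF _ bounded_linear_inner_left])
  fix y assume "y \<in> S"
  then have "linear (frechet_derivative Y (at y))"
    using smooth_on_has_derivative[OF assms(1,3)] has_derivative_linear by blast
  then have "frechet_derivative Y (at y) (\<Sum>b\<in>Basis. (X y \<bullet> b) *\<^sub>R b)
      = (\<Sum>b\<in>Basis. (X y \<bullet> b) *\<^sub>R frechet_derivative Y (at y) b)"
    by (simp add: linear_sum linear_scale)
  then show "(\<Sum>b\<in>Basis. (X y \<bullet> b) *\<^sub>R frechet_derivative Y (at y) b)
      = frechet_derivative Y (at y) (X y)"
    by (simp add: euclidean_representation)
qed

lemma smooth_on_lie_bracket:
  assumes "open S" "smooth_on S X" "smooth_on S Y"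
  shows "smooth_on S (lie_bracket X Y)"
  unfolding lie_bracket_def[abs_def]
  by (intro smooth_on_diff smooth_on_frechet_derivative_field assms)

lemma frechet_derivative_compose_bounded_linear:
  assumes "bounded_linear P" "f differentiable at (P x)"
  shows "frechet_derivative (\<lambda>x. f (P x)) (at x) v = frechet_derivative f (at (P x)) (P v)"
proof -
  have "((\<lambda>x. f (P x)) has_derivative (\<lambda>v. frechet_derivative f (at (P x)) (P v))) (at x)"
    using has_derivative_compose[OF bounded_linear_imp_has_derivative[OF assms(1)]]
      assms(2) frechet_derivative_works by blast
  then show ?thesis
    by (simp add: frechet_derivative_eqI)
qed

lemma bounded_linear_frechet_derivative:
  assumes "bounded_linear L" "f differentiable at x"
  shows "L (frechet_derivative f (at x) v) = frechet_derivative (\<lambda>x. L (f x)) (at x) v"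
  using bounded_linear.has_derivative[OF assms(1)] assms(2) frechet_derivative_works
  by (metis frechet_derivative_eqI)

section \<open>Linear connections in a frame\<close>

context
  fixes W :: "'a::euclidean_space set" and D :: "'a connection"
  assumes W: "open W" and D: "linear_connection_on W D"
begin

lemma connection_smooth: "smooth_on W X \<Longrightarrow> smooth_on W Y \<Longrightarrow> smooth_on W (D X Y)"
  using D unfolding linear_connection_on_def by simp

lemma connection_add_left:
  assumes "smooth_on W X" "smooth_on W X'" "smooth_on W Y" "y \<in> W"
  shows "D (\<lambda>z. X z + X' z) Y y = D X Y y + D X' Y y"
  using D[unfolded linear_connection_on_def, THEN conjunct2, THEN conjunct1] assms by simp

lemma connection_scale_left:
  fixes f :: "'a \<Rightarrow> real"
  assumes "smooth_on W f" "smooth_on W X" "smooth_on W Y" "y \<in> W"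
  shows "D (\<lambda>z. f z *\<^sub>R X z) Y y = f y *\<^sub>R D X Y y"
  using D[unfolded linear_connection_on_def, THEN conjunct2, THEN conjunct2, THEN conjunct1] assms
  by simp

lemma connection_add_right:
  assumes "smooth_on W X" "smooth_on W Y" "smooth_on W Y'" "y \<in> W"
  shows "D X (\<lambda>z. Y z + Y' z) y = D X Y y + D X Y' y"
  using D[unfolded linear_connection_on_def, THEN conjunct2, THEN conjunct2, THEN conjunct2,
      THEN conjunct1] assms by simp

lemma connection_leibniz:
  fixes f :: "'a \<Rightarrow> real"
  assumes "smooth_on W f" "smooth_on W X" "smooth_on W Y" "y \<in> W"
  shows "D X (\<lambda>z. f z *\<^sub>R Y z) y
    = frechet_derivative f (at y) (X y) *\<^sub>R Y y + f y *\<^sub>R D X Y y"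
  using D[unfolded linear_connection_on_def, THEN conjunct2, THEN conjunct2, THEN conjunct2,
      THEN conjunct2] assms by simp

text \<open>A connection acts on total functions, so it has to be shown that only the values of a
  field on \<open>W\<close> matter.\<close>

lemma connection_cong_left:
  assumes "smooth_on W X" "smooth_on W X'" "smooth_on W Y" "\<And>z. z \<in> W \<Longrightarrow> X z = X' z" "y \<in> W"
  shows "D X Y y = D X' Y y"
proof -
  \<comment> \<open>\<open>?f\<close> vanishes on \<open>W\<close> and is 1 elsewhere, while
    \<open>?Z\<close> vanishes on \<open>W\<close>; hence \<open>?f\<close> times \<open>?Z\<close>
    is \<open>?Z\<close> as a total function. Pulling \<open>?f\<close> out of the connection then
    gives zero on \<open>W\<close>.\<close>
  let ?Z = "\<lambda>z. X z - X' z" and ?f = "\<lambda>z. if z \<in> W then 0 else 1 :: real"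
  have f: "smooth_on W ?f"
    by (rule smooth_on_cong[OF W _ smooth_on_const[of _ 0]]) simp
  have Z: "smooth_on W ?Z"
    by (intro smooth_on_diff W assms)
  have fZ: "(\<lambda>z. ?f z *\<^sub>R ?Z z) = ?Z"
    using assms(4) by auto
  have "D (\<lambda>z. ?f z *\<^sub>R ?Z z) Y y = ?f y *\<^sub>R D ?Z Y y"
    by (rule connection_scale_left[OF f Z assms(3,5)])
  then have "D ?Z Y y = 0"
    unfolding fZ using assms(5) by simp
  moreover have "D (\<lambda>z. X' z + ?Z z) Y y = D X' Y y + D ?Z Y y"
    by (rule connection_add_left[OF assms(2) Z assms(3,5)])
  ultimately show ?thesis by simp
qed

lemma connection_cong_right:
  assumes "smooth_on W X" "smooth_on W Y" "smooth_on W Y'" "\<And>z. z \<in> W \<Longrightarrow> Y z = Y' z" "y \<in> W"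
  shows "D X Y y = D X Y' y"
proof -
  let ?Z = "\<lambda>z. Y z - Y' z" and ?f = "\<lambda>z. if z \<in> W then 0 else 1 :: real"
  have f: "smooth_on W ?f"
    by (rule smooth_on_cong[OF W _ smooth_on_const[of _ 0]]) simp
  have Z: "smooth_on W ?Z"
    by (intro smooth_on_diff W assms)
  have fZ: "(\<lambda>z. ?f z *\<^sub>R ?Z z) = ?Z"
    using assms(4) by auto
  \<comment> \<open>The Leibniz rule adds a derivative term here; it vanishes because
    \<open>?f\<close> is zero in a neighbourhood of \<open>y\<close>.\<close>
  have f': "frechet_derivative ?f (at y) = frechet_derivative (\<lambda>z. 0) (at y)"
    by (rule frechet_derivative_cong_open[OF W assms(5)]) simp
  have "D X (\<lambda>z. ?f z *\<^sub>R ?Z z) y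
      = frechet_derivative ?f (at y) (X y) *\<^sub>R ?Z y + ?f y *\<^sub>R D X ?Z y"
    by (rule connection_leibniz[OF f assms(1) Z assms(5)])
  then have "D X ?Z y = 0"
    unfolding fZ f' using assms(5) by (simp add: frechet_derivative_const)
  moreover have "D X (\<lambda>z. Y' z + ?Z z) y = D X Y' y + D X ?Z y"
    by (rule connection_add_right[OF assms(1,3) Z assms(5)])
  ultimately show ?thesis by simp
qed

lemma connection_zero_left:
  assumes "smooth_on W Y" "y \<in> W"
  shows "D (\<lambda>z. 0) Y y = 0"
  using connection_scale_left[OF smooth_on_const[of W 0] smooth_on_const[of W 0] assms] by simp

lemma connection_zero_right:
  assumes "smooth_on W X" "y \<in> W"
  shows "D X (\<lambda>z. 0) y = 0"
  using connection_leibniz[OF smooth_on_const[of W 0] assms(1) smooth_on_const[of W 0] assms(2)]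
  by simp

lemma connection_sum_left:
  assumes "finite I" "\<And>i. i \<in> I \<Longrightarrow> smooth_on W (X i)" "smooth_on W Y" "y \<in> W"
  shows "D (\<lambda>z. \<Sum>i\<in>I. X i z) Y y = (\<Sum>i\<in>I. D (X i) Y y)"
  using assms(1,2)
proof (induction I)
  case empty
  then show ?case using connection_zero_left assms by simp
next
  case (insert i I)
  have "D (\<lambda>z. X i z + (\<Sum>i\<in>I. X i z)) Y y = D (X i) Y y + D (\<lambda>z. \<Sum>i\<in>I. X i z) Y y"
    using insert.prems by (intro connection_add_left smooth_on_sum W assms(3,4)) auto
  then show ?case using insert by simp
qed

lemma connection_sum_right:
  assumes "finite I" "\<And>i. i \<in> I \<Longrightarrow> smooth_on W (Y i)" "smooth_on W X" "y \<in> W"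
  shows "D X (\<lambda>z. \<Sum>i\<in>I. Y i z) y = (\<Sum>i\<in>I. D X (Y i) y)"
  using assms(1,2)
proof (induction I)
  case empty
  then show ?case using connection_zero_right assms by simp
next
  case (insert i I)
  have "D X (\<lambda>z. Y i z + (\<Sum>i\<in>I. Y i z)) y = D X (Y i) y + D X (\<lambda>z. \<Sum>i\<in>I. Y i z) y"
    using insert.prems by (intro connection_add_right smooth_on_sum W assms(3,4)) auto
  then show ?case using insert by simp
qed

section \<open>Curvature from connection coefficients in a frame\<close>

context
  fixes X :: "'i::finite \<Rightarrow> 'a \<Rightarrow> 'a" and \<Gamma> :: "'i \<Rightarrow> 'i \<Rightarrow> 'i \<Rightarrow> 'a \<Rightarrow> real"
  assumes X: "\<And>A. smooth_on W (X A)"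
    and \<Gamma>: "\<And>E A B. smooth_on W (\<Gamma> E A B)"
    and DX: "\<And>A B z. z \<in> W \<Longrightarrow> D (X B) (X A) z = (\<Sum>E\<in>UNIV. \<Gamma> E A B z *\<^sub>R X E z)"
begin

text \<open>The expansion of \<open>D (X B) (X A)\<close> is known on \<open>W\<close> only, hence
  \<open>connection_cong_right\<close>. The Leibniz rule then yields derivatives of the coefficients
  and a quadratic term, whose sums are exchanged to collect the factor of each frame field.\<close>

lemma connection_connection_frame:
  assumes "y \<in> W"
  shows "D (X C) (D (X B) (X A)) y
    = (\<Sum>F\<in>UNIV. (frechet_derivative (\<Gamma> F A B) (at y) (X C y)
        + (\<Sum>E\<in>UNIV. \<Gamma> E A B y * \<Gamma> F E C y)) *\<^sub>R X F y)"
proof -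
  have s: "smooth_on W (\<lambda>z. \<Gamma> E A B z *\<^sub>R X E z)" for E
    by (intro smooth_on_scaleR W X \<Gamma>)
  have "smooth_on W (D (X B) (X A))"
    by (intro connection_smooth X)
  then have "D (X C) (D (X B) (X A)) y = D (X C) (\<lambda>z. \<Sum>E\<in>UNIV. \<Gamma> E A B z *\<^sub>R X E z) y"
    using s by (intro connection_cong_right smooth_on_sum W X DX assms)
  also have "\<dots> = (\<Sum>E\<in>UNIV. D (X C) (\<lambda>z. \<Gamma> E A B z *\<^sub>R X E z) y)"
    using s by (intro connection_sum_right X assms) auto
  also have "\<dots> = (\<Sum>E\<in>UNIV. frechet_derivative (\<Gamma> E A B) (at y) (X C y) *\<^sub>R X E y)
      + (\<Sum>E\<in>UNIV. \<Sum>F\<in>UNIV. (\<Gamma> E A B y * \<Gamma> F E C y) *\<^sub>R X F y)"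
    by (simp add: connection_leibniz[OF \<Gamma> X X assms] DX[OF assms] sum.distrib scaleR_sum_right)
  also have "(\<Sum>E\<in>UNIV. \<Sum>F\<in>UNIV. (\<Gamma> E A B y * \<Gamma> F E C y) *\<^sub>R X F y)
      = (\<Sum>F\<in>UNIV. (\<Sum>E\<in>UNIV. \<Gamma> E A B y * \<Gamma> F E C y) *\<^sub>R X F y)"
    by (subst sum.swap) (simp add: scaleR_sum_left)
  finally show ?thesis
    by (simp add: scaleR_left_distrib sum.distrib)
qed

text \<open>The classical coordinate formula with frame derivatives in place of partial derivatives.
  Frame fields need not commute, so the contribution of their bracket is excluded by
  assumption.\<close>

lemma curvature_frame:
  assumes "y \<in> W" "D (lie_bracket (X C) (X B)) (X A) y = 0"
  shows "curvature D (X C) (X B) (X A) y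
    = (\<Sum>F\<in>UNIV. (frechet_derivative (\<Gamma> F A B) (at y) (X C y)
        - frechet_derivative (\<Gamma> F A C) (at y) (X B y)
        + (\<Sum>E\<in>UNIV. \<Gamma> E A B y * \<Gamma> F E C y) - (\<Sum>E\<in>UNIV. \<Gamma> E A C y * \<Gamma> F E B y)) *\<^sub>R X F y)"
  unfolding curvature_def connection_connection_frame[OF assms(1)] assms(2)
  by (simp add: sum_subtractf[symmetric] scaleR_left_diff_distrib[symmetric] algebra_simps)

end

end

section \<open>The adapted frame\<close>

lemma sum_fidx:
  "(\<Sum>A\<in>UNIV. f A) = (\<Sum>\<alpha>\<in>UNIV. f (tI \<alpha>)) + (\<Sum>i\<in>UNIV. f (xI i))
    + (\<Sum>i\<in>UNIV. \<Sum>\<alpha>\<in>UNIV. f (vI i \<alpha>))"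
  for f :: "('p::finite, 'n::finite) fidx \<Rightarrow> 'b::comm_monoid_add"
proof -
  have split: "(\<Sum>A\<in>UNIV. k A) = (\<Sum>a\<in>UNIV. k (Inl a)) + (\<Sum>b\<in>UNIV. k (Inr b))"
    for k :: "'c::finite + 'd::finite \<Rightarrow> 'b"
    using sum.Plus[of UNIV UNIV k] by (simp add: UNIV_Plus_UNIV)
  have "(\<Sum>i\<in>UNIV. \<Sum>\<alpha>\<in>UNIV. f (vI i \<alpha>)) = (\<Sum>B\<in>UNIV. f (Inr (Inr B)))"
    by (simp add: sum.cartesian_product UNIV_Times_UNIV)
  then show ?thesis by (simp add: split add.assoc)
qed

lemma all_fidx:
  "(\<forall>A. P A) \<longleftrightarrow> (\<forall>\<alpha>. P (tI \<alpha>)) \<and> (\<forall>i. P (xI i)) \<and> (\<forall>i \<alpha>. P (vI i \<alpha>))"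
  for P :: "('p, 'n) fidx \<Rightarrow> bool"
  by (metis obj_sumE surj_pair)

lemma fidx_cases [case_names t x v]:
  fixes A :: "('p, 'n) fidx"
  obtains \<alpha> where "A = tI \<alpha>" | i where "A = xI i" | i \<alpha> where "A = vI i \<alpha>"
  by (metis obj_sumE surj_pair)

text \<open>The nonlinear connection enters the frame with a minus sign and the coframe with a plus
  sign, so it cancels in the vertical entries.\<close>

lemma coframe_frame: "coframe h g U A y (frame h g U B y) = (if A = B then 1 else 0)"
proof (cases y)
  case (fields t x v)
  then show ?thesis
    by (cases A rule: coframe.cases[of "(A, y, y)" for A, case_names 1 2 3])
      (cases B rule: frame.cases[of "(B, y)" for B, case_names 1 2 3];
       auto simp: axis_def if_distrib cong: if_cong)+
qed

lemma linear_coframe: "linear (coframe h g U A y)"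
proof (rule linearI)
  show "coframe h g U A y (X + Y) = coframe h g U A y X + coframe h g U A y Y" for X Y
    by (cases "(A, y, X)" rule: coframe.cases; cases Y)
      (auto simp: algebra_simps sum.distrib)
  show "coframe h g U A y (r *\<^sub>R X) = r *\<^sub>R coframe h g U A y X" for r X
    by (cases "(A, y, X)" rule: coframe.cases)
      (auto simp: algebra_simps sum_distrib_left)
qed

lemma vec_axis_expansion: "(\<Sum>i\<in>UNIV. a $ i *\<^sub>R axis i (1::real)) = a"
  by (simp add: vec_eq_iff axis_def if_distrib cong: if_cong)

lemma sum_axis_axis:
  "(\<Sum>k\<in>UNIV. \<Sum>\<gamma>\<in>UNIV. c k \<gamma> * axis k (axis \<gamma> (1::real)) $ i $ \<alpha>) = c i \<alpha>"
proof -
  have "(\<Sum>\<gamma>\<in>UNIV. c k \<gamma> * axis k (axis \<gamma> (1::real)) $ i $ \<alpha>) = (if k = i then c k \<alpha> else 0)" for k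
    by (cases "k = i") (simp_all add: axis_def if_distrib[of "\<lambda>r. _ * r"] cong: if_cong)
  then show ?thesis by simp
qed

text \<open>Together with duality this makes the adapted frame a basis at every point, so that
  bilinear forms may be compared on it.\<close>

lemma frame_expansion: "(\<Sum>A\<in>UNIV. coframe h g U A y X *\<^sub>R frame h g U A y) = X"
proof -
  obtain a b e where X: "X = (a, b, e)" by (cases X)
  have "fst (\<Sum>A\<in>UNIV. coframe h g U A y X *\<^sub>R frame h g U A y) = a"
    by (simp add: X fst_sum sum_fidx vec_axis_expansion)
  moreover have "fst (snd (\<Sum>A\<in>UNIV. coframe h g U A y X *\<^sub>R frame h g U A y)) = b"
    by (simp add: X fst_sum snd_sum sum_fidx vec_axis_expansion)
  moreover have "snd (snd (\<Sum>A\<in>UNIV. coframe h g U A y X *\<^sub>R frame h g U A y)) = e"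
    by (simp add: X snd_sum sum_fidx vec_eq_iff sum_negf sum_axis_axis) (simp add: mult.commute)
  ultimately show ?thesis
    unfolding X prod_eq_iff fst_conv snd_conv by blast
qed

section \<open>Bilinear forms and the block form of the metric\<close>

lemma bilinear_frame_expansion:
  assumes "bilinear T"
  shows "T X Y = (\<Sum>A\<in>UNIV. \<Sum>B\<in>UNIV.
    T (frame h g U A y) (frame h g U B y) * coframe h g U A y X * coframe h g U B y Y)"
proof -
  let ?c = "\<lambda>A. coframe h g U A y" and ?e = "\<lambda>A. frame h g U A y"
  have "T X Y = T (\<Sum>A\<in>UNIV. ?c A X *\<^sub>R ?e A) (\<Sum>B\<in>UNIV. ?c B Y *\<^sub>R ?e B)"
    unfolding frame_expansion ..
  also have "\<dots> = (\<Sum>(A, B)\<in>UNIV \<times> UNIV. T (?c A X *\<^sub>R ?e A) (?c B Y *\<^sub>R ?e B))"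
    by (rule bilinear_sum[OF assms])
  finally show ?thesis
    by (simp add: sum.cartesian_product bilinear_lmul[OF assms] bilinear_rmul[OF assms] mult_ac)
qed

text \<open>Reads off the coefficients of a form written in products of coframe values; used alike
  for the Ricci tensor, the potential and the stress-energy tensor.\<close>

lemma frame_form_frame:
  "(\<Sum>A\<in>UNIV. \<Sum>B\<in>UNIV. a A B * coframe h g U A y (frame h g U C y)
      * coframe h g U B y (frame h g U E y)) = a C E"
proof -
  have "(\<Sum>A\<in>UNIV. \<Sum>B\<in>UNIV. a A B * coframe h g U A y (frame h g U C y)
      * coframe h g U B y (frame h g U E y)) = (\<Sum>A\<in>UNIV. if A = C then a A E else 0)"
    by (intro sum.cong refl) (auto simp: coframe_frame if_distrib cong: if_cong)
  then show ?thesis by simp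
qed

text \<open>One pattern serves the potential, with blocks built from \<open>h\<close>,
  \<open>g\<close> and the inverse of \<open>h\<close>, and its inverse matrix, with
  \<open>h\<close> and its inverse exchanged and \<open>g\<close> inverted. The vertical block is a
  Kronecker product of \<open>c\<close> and \<open>b\<close>.\<close>

fun block_metric :: "real^'p^'p \<Rightarrow> real^'n^'n \<Rightarrow> real^'p^'p
    \<Rightarrow> ('p, 'n) fidx \<Rightarrow> ('p, 'n) fidx \<Rightarrow> real" where
  "block_metric a b c (Inl \<alpha>) (Inl \<beta>) = a $ \<alpha> $ \<beta>"
| "block_metric a b c (Inr (Inl i)) (Inr (Inl j)) = b $ i $ j"
| "block_metric a b c (Inr (Inr (i, \<alpha>))) (Inr (Inr (j, \<beta>))) = c $ \<alpha> $ \<beta> * b $ i $ j"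
| "block_metric a b c _ _ = 0"

lemma grav_potential_block:
  "grav_potential h g U (t, x, v) X Y = (\<Sum>A\<in>UNIV. \<Sum>B\<in>UNIV.
    block_metric (h t) (g x) (matrix_inv (h t)) A B
      * coframe h g U A (t, x, v) X * coframe h g U B (t, x, v) Y)"
proof -
  \<comment> \<open>The potential sums in the order \<open>\<alpha> \<beta> i j\<close>, whereas a
    sum over two vertical frame indices runs over \<open>i \<alpha> j \<beta>\<close>.\<close>
  have "(\<Sum>\<alpha>\<in>UNIV. \<Sum>\<beta>\<in>UNIV. \<Sum>i\<in>UNIV. \<Sum>j\<in>UNIV. f \<alpha> \<beta> i j)
      = (\<Sum>i\<in>UNIV. \<Sum>\<alpha>\<in>UNIV. \<Sum>j\<in>UNIV. \<Sum>\<beta>\<in>UNIV. f \<alpha> \<beta> i j)"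
    for f :: "'a \<Rightarrow> 'a \<Rightarrow> 'b \<Rightarrow> 'b \<Rightarrow> real"
  proof -
    have "(\<Sum>\<alpha>\<in>UNIV. \<Sum>\<beta>\<in>UNIV. \<Sum>i\<in>UNIV. \<Sum>j\<in>UNIV. f \<alpha> \<beta> i j)
        = (\<Sum>\<alpha>\<in>UNIV. \<Sum>i\<in>UNIV. \<Sum>\<beta>\<in>UNIV. \<Sum>j\<in>UNIV. f \<alpha> \<beta> i j)"
      by (intro sum.cong refl) (rule sum.swap)
    also have "\<dots> = (\<Sum>i\<in>UNIV. \<Sum>\<alpha>\<in>UNIV. \<Sum>\<beta>\<in>UNIV. \<Sum>j\<in>UNIV. f \<alpha> \<beta> i j)"
      by (rule sum.swap)
    also have "\<dots> = (\<Sum>i\<in>UNIV. \<Sum>\<alpha>\<in>UNIV. \<Sum>j\<in>UNIV. \<Sum>\<beta>\<in>UNIV. f \<alpha> \<beta> i j)"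
      by (intro sum.cong refl) (rule sum.swap)
    finally show ?thesis .
  qed
  then show ?thesis
    by (simp add: sum_fidx del: coframe.simps)
qed

text \<open>The three blocks multiply separately, and in the vertical one the double sum factors: a
  Kronecker product of inverses inverts the Kronecker product.\<close>

lemma block_metric_mult:
  assumes "a ** a' = mat 1" "b ** b' = mat 1" "c ** c' = mat 1"
  shows "(\<Sum>B\<in>UNIV. block_metric a b c A B * block_metric a' b' c' B C) = (if A = C then 1 else 0)"
proof -
  have e: "(\<Sum>k\<in>UNIV. m $ i $ k * m' $ k $ j) = (if i = j then 1 else 0)"
    if "m ** m' = mat 1" for m m' :: "real^'k^'k" and i j
    using that by (simp add: vec_eq_iff matrix_matrix_mult_def mat_def)
  have "(\<Sum>k\<in>UNIV. \<Sum>\<gamma>\<in>UNIV. (c $ \<alpha> $ \<gamma> * b $ i $ k) * (c' $ \<gamma> $ \<beta> * b' $ k $ j))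
      = (\<Sum>k\<in>UNIV. b $ i $ k * b' $ k $ j) * (\<Sum>\<gamma>\<in>UNIV. c $ \<alpha> $ \<gamma> * c' $ \<gamma> $ \<beta>)" for \<alpha> \<beta> i j
    unfolding sum_product by (intro sum.cong refl) (simp add: mult_ac)
  then show ?thesis
    by (cases "(a, b, c, A, C)" rule: block_metric.cases)
      (auto simp: sum_fidx e[OF assms(1)] e[OF assms(2)] e[OF assms(3)])
qed

lemma matrix_inv_G_mat:
  assumes "invertible (h t)" "invertible (g x)"
  shows "matrix_inv (G_mat h g U (t, x, v)) $ A $ B
    = block_metric (matrix_inv (h t)) (matrix_inv (g x)) (h t) A B"
proof -
  have "matrix_inv (G_mat h g U (t, x, v))
      = (\<chi> A B. block_metric (matrix_inv (h t)) (matrix_inv (g x)) (h t) A B)"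
  proof (rule matrix_inv_eqI)
    show "G_mat h g U (t, x, v)
        ** (\<chi> A B. block_metric (matrix_inv (h t)) (matrix_inv (g x)) (h t) A B) = mat 1"
      unfolding G_mat_def grav_potential_block frame_form_frame
      by (simp add: vec_eq_iff matrix_matrix_mult_def mat_def
          block_metric_mult[OF matrix_mul_matrix_inv(1)[OF assms(1)]
            matrix_mul_matrix_inv(1)[OF assms(2)] matrix_mul_matrix_inv(2)[OF assms(1)]])
  qed
  then show ?thesis by simp
qed

section \<open>Curvature of the Cartan connection in one chart\<close>

lemma nlM_eq: "nlM h y i \<alpha> \<beta>
    = - (\<Sum>\<gamma>\<in>UNIV. christoffel h (fst y) \<gamma> \<alpha> \<beta> * snd (snd y) $ i $ \<gamma>)"
  by (cases y) simp

lemma nlN_eq: "nlN h g U y i \<alpha> j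
    = (\<Sum>k\<in>UNIV. christoffel g (fst (snd y)) i j k * snd (snd y) $ k $ \<alpha>)
      + (\<Sum>\<gamma>\<in>UNIV. \<Sum>l\<in>UNIV. h (fst y) $ \<alpha> $ \<gamma> * matrix_inv (g (fst (snd y))) $ i $ l / 4
          * U_curl U (fst y) (fst (snd y)) \<gamma> l j)"
  by (cases y) simp

lemma matrix_axis_expansion: "(\<chi> j \<beta>. m j \<beta>)
    = (\<Sum>j\<in>UNIV. \<Sum>\<beta>\<in>UNIV. m j \<beta> *\<^sub>R axis j (axis \<beta> (1::real)))"
  by (simp add: vec_eq_iff sum_axis_axis)

lemma smooth_on_matrixI:
  assumes "open W" "\<And>j \<beta>. smooth_on W (\<lambda>y. m y j \<beta> :: real)"
  shows "smooth_on W (\<lambda>y. \<chi> j \<beta>. m y j \<beta>)"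
  unfolding matrix_axis_expansion
  by (intro smooth_on_sum smooth_on_scaleR smooth_on_const assms)

lemma smooth_on_Pair:
  assumes "open W" "smooth_on W f" "smooth_on W g"
  shows "smooth_on W (\<lambda>y. (f y, g y))"
proof -
  have "bounded_linear (\<lambda>a. (a, 0))" "bounded_linear (\<lambda>b. (0, b))"
    by (intro bounded_linear_Pair bounded_linear_ident bounded_linear_zero)+
  then have "smooth_on W (\<lambda>y. (f y, 0) + (0, g y))"
    using smooth_on_bounded_linear[OF assms(1) _ assms(2)]
      smooth_on_bounded_linear[OF assms(1) _ assms(3)] by (intro smooth_on_add assms(1))
  then show ?thesis by simp
qed

text \<open>\<open>cartan_coef h g E A B\<close> is the coefficient of \<open>X\<^sub>E\<close> in \<open>\<nabla>\<close> of \<open>X\<^sub>A\<close> along \<open>X\<^sub>B\<close>.\<close>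

fun cartan_coef :: "(real^'p \<Rightarrow> real^'p^'p) \<Rightarrow> (real^'n \<Rightarrow> real^'n^'n) \<Rightarrow>
    ('p::finite, 'n::finite) fidx \<Rightarrow> ('p, 'n) fidx \<Rightarrow> ('p, 'n) fidx \<Rightarrow> ('p, 'n) jvec \<Rightarrow> real" where
  "cartan_coef h g (Inl \<beta>) (Inl \<alpha>) (Inl \<gamma>) = (\<lambda>y. christoffel h (fst y) \<beta> \<alpha> \<gamma>)"
| "cartan_coef h g (Inr (Inl k)) (Inr (Inl i)) (Inr (Inl j))
     = (\<lambda>y. christoffel g (fst (snd y)) k i j)"
| "cartan_coef h g (Inr (Inr (k, \<beta>))) (Inr (Inr (i, \<alpha>))) (Inl \<gamma>)
     = (if k = i then \<lambda>y. - christoffel h (fst y) \<alpha> \<beta> \<gamma> else (\<lambda>y. 0))"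
| "cartan_coef h g (Inr (Inr (k, \<beta>))) (Inr (Inr (i, \<alpha>))) (Inr (Inl j))
     = (if \<beta> = \<alpha> then \<lambda>y. christoffel g (fst (snd y)) k i j else (\<lambda>y. 0))"
| "cartan_coef h g _ _ _ = (\<lambda>y. 0)"

text \<open>\<open>S\<close> and \<open>R\<close> stand for the images of the two charts. The image
  of the induced jet chart is \<open>W\<close> below, whose fibre is the whole matrix space.\<close>

locale edml_chart =
  fixes S :: "(real^'p::finite) set" and R :: "(real^'n::finite) set"
    and h :: "real^'p \<Rightarrow> real^'p^'p" and g :: "real^'n \<Rightarrow> real^'n^'n"
    and U :: "real^'p \<Rightarrow> real^'n \<Rightarrow> real^'p^'n"
  assumes open_S: "open S" and open_R: "open R"
    and smooth_h: "smooth_on S h" and smooth_g: "smooth_on R g"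
    and invertible_h: "\<And>t. t \<in> S \<Longrightarrow> invertible (h t)"
    and invertible_g: "\<And>x. x \<in> R \<Longrightarrow> invertible (g x)"
    and smooth_U: "smooth_on (S \<times> R) (\<lambda>(t, x). U t x)"
begin

abbreviation "W \<equiv> S \<times> R \<times> (UNIV :: (real^'p^'n) set)"

abbreviation "X \<equiv> frame h g U"

lemma open_W: "open W"
  by (intro open_Times open_S open_R open_UNIV)

lemma smooth_on_W_fst: "smooth_on S f \<Longrightarrow> smooth_on W (\<lambda>y. f (fst y))"
  by (rule smooth_on_compose_bounded_linear[OF open_S open_W bounded_linear_fst]) auto

lemma bounded_linear_fst_snd: "bounded_linear (\<lambda>y. fst (snd y))"
  by (rule bounded_linear_compose[OF bounded_linear_fst bounded_linear_snd])

lemma smooth_on_W_fst_snd: "smooth_on R f \<Longrightarrow> smooth_on W (\<lambda>y. f (fst (snd y)))"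
  by (rule smooth_on_compose_bounded_linear[OF open_R open_W bounded_linear_fst_snd]) auto

lemma smooth_christoffel_h: "smooth_on S (\<lambda>t. christoffel h t i j k)"
  by (rule smooth_on_christoffel[OF open_S smooth_h invertible_h])

lemma smooth_christoffel_g: "smooth_on R (\<lambda>x. christoffel g x i j k)"
  by (rule smooth_on_christoffel[OF open_R smooth_g invertible_g])

text \<open>Here \<open>t\<close> is frozen, whereas \<open>smooth_U\<close> concerns both variables
  jointly. The partial derivative is identified with the joint derivative in the fixed direction
  \<open>(0, axis j 1)\<close>.\<close>

lemma smooth_U_pd:
  "smooth_on W (\<lambda>y. pd j (\<lambda>z. U (fst y) z $ l $ \<gamma>) (fst (snd y)))"
proof -
  let ?u = "\<lambda>(t, x). U t x"
  let ?F = "\<lambda>q. frechet_derivative ?u (at q) (0, axis j 1) $ l $ \<gamma>"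
  have SR: "open (S \<times> R)"
    by (intro open_Times open_S open_R)
  have P: "bounded_linear (\<lambda>y :: ('p, 'n) jvec. (fst y, fst (snd y)))"
    by (intro bounded_linear_Pair bounded_linear_fst bounded_linear_fst_snd)
  have "smooth_on (S \<times> R) ?F"
    by (intro smooth_on_matrix_nth smooth_on_frechet_derivative smooth_U SR)
  then have "smooth_on W (\<lambda>y. ?F (fst y, fst (snd y)))"
    by (rule smooth_on_compose_bounded_linear[OF SR open_W P, rotated]) auto
  moreover have "?F (fst y, fst (snd y)) = pd j (\<lambda>z. U (fst y) z $ l $ \<gamma>) (fst (snd y))"
    if "y \<in> W" for y
  proof -
    obtain t x v where y: "y = (t, x, v)" by (cases y)
    have "(?u has_derivative frechet_derivative ?u (at (t, x))) (at (t, x))"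
      using smooth_on_has_derivative[OF SR smooth_U] that y by auto
    moreover have "((\<lambda>z. (t, z)) has_derivative (\<lambda>z. (0, z))) (at x)"
      by (intro has_derivative_Pair has_derivative_const has_derivative_ident)
    ultimately have "((\<lambda>z. ?u (t, z)) has_derivative
        (\<lambda>z. frechet_derivative ?u (at (t, x)) (0, z))) (at x)"
      using has_derivative_compose[of "\<lambda>z. (t, z)" "\<lambda>z. (0, z)" x UNIV ?u] by simp
    then have "((\<lambda>z. U t z) has_derivative
        (\<lambda>z. frechet_derivative ?u (at (t, x)) (0, z))) (at x)"
      by simp
    then have "((\<lambda>z. U t z $ l $ \<gamma>) has_derivative
        (\<lambda>z. frechet_derivative ?u (at (t, x)) (0, z) $ l $ \<gamma>)) (at x)"
      by (intro bounded_linear.has_derivative[OF bounded_linear_vec_nth])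
    then show ?thesis
      by (simp add: y pd_def frechet_derivative_eqI)
  qed
  ultimately show ?thesis
    using smooth_on_cong[OF open_W] by (metis (no_types, lifting))
qed

lemma smooth_velocity: "smooth_on W (\<lambda>y. snd (snd y) $ i $ \<alpha>)"
  by (intro smooth_on_matrix_nth open_W smooth_on_bounded_linear[OF open_W _ smooth_on_id[OF open_W]]
      bounded_linear_compose[OF bounded_linear_snd bounded_linear_snd])

lemma smooth_nlM: "smooth_on W (\<lambda>y. nlM h y i \<alpha> \<beta>)"
  unfolding nlM_eq
  by (intro smooth_on_minus smooth_on_sum smooth_on_mult open_W smooth_velocity
      smooth_on_W_fst smooth_christoffel_h)

lemma smooth_nlN: "smooth_on W (\<lambda>y. nlN h g U y i \<alpha> j)"
  unfolding nlN_eq U_curl_def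
  by (intro smooth_on_add smooth_on_sum smooth_on_mult smooth_on_divide smooth_on_diff open_W
      smooth_velocity smooth_U_pd smooth_on_const
      smooth_on_W_fst_snd[OF smooth_christoffel_g]
      smooth_on_W_fst[OF smooth_on_matrix_nth[OF open_S smooth_h]]
      smooth_on_W_fst_snd[OF smooth_on_matrix_inv[OF open_R smooth_g invertible_g]]) simp_all

section \<open>Smoothness, brackets and derivatives along the frame\<close>

lemma smooth_frame: "smooth_on W (X A)"
proof -
  have "(\<forall>\<alpha>. smooth_on W (X (tI \<alpha>))) \<and> (\<forall>i. smooth_on W (X (xI i)))
      \<and> (\<forall>i \<alpha>. smooth_on W (X (vI i \<alpha>)))"
    unfolding frame.simps[abs_def]
    by (intro conjI allI smooth_on_Pair smooth_on_minus smooth_on_matrixI smooth_nlM smooth_nlN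
        smooth_on_const open_W)
  then show ?thesis
    using all_fidx[of "\<lambda>A. smooth_on W (X A)"] by blast
qed

lemma smooth_cartan_coef: "smooth_on W (cartan_coef h g E A B)"
  by (cases "(h, g, E, A, B)" rule: cartan_coef.cases)
    (auto intro!: smooth_on_const smooth_on_minus[OF open_S] smooth_on_W_fst smooth_on_W_fst_snd
      smooth_christoffel_h smooth_christoffel_g)

lemma fst_frame: "fst (X A y) = (case A of Inl \<alpha> \<Rightarrow> axis \<alpha> 1 | _ \<Rightarrow> 0)"
  by (cases A rule: frame.cases[of "(A, y)" for A, case_names 1 2 3]) auto

lemma fst_snd_frame: "fst (snd (X A y)) = (case A of Inr (Inl i) \<Rightarrow> axis i 1 | _ \<Rightarrow> 0)"
  by (cases A rule: frame.cases[of "(A, y)" for A, case_names 1 2 3]) auto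

text \<open>The first two components of every frame field are constant, so the bracket has only a
  fibre component, and the vertical frame fields span the fibre directions.\<close>

lemma lie_bracket_frame_vertical:
  assumes "y \<in> W"
  shows "lie_bracket (X C) (X B) y
    = (\<Sum>p\<in>UNIV. (snd (snd (lie_bracket (X C) (X B) y)) $ fst p $ snd p) *\<^sub>R X (Inr (Inr p)) y)"
proof -
  have d: "X A differentiable at y" for A
    using smooth_on_has_derivative[OF open_W smooth_frame assms] by (rule differentiableI)
  have "fst (frechet_derivative (X A) (at y) v) = 0" for A v
    unfolding bounded_linear_frechet_derivative[OF bounded_linear_fst d] fst_frame
    by (simp add: frechet_derivative_const)
  moreover have "fst (snd (frechet_derivative (X A) (at y) v)) = 0" for A v
    unfolding bounded_linear_frechet_derivative[OF bounded_linear_fst_snd d] fst_snd_frame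
    by (simp add: frechet_derivative_const)
  ultimately have "fst (lie_bracket (X C) (X B) y) = 0" "fst (snd (lie_bracket (X C) (X B) y)) = 0"
    by (simp_all add: lie_bracket_def)
  then obtain e where e: "lie_bracket (X C) (X B) y = (0, 0, e)"
    by (metis prod.collapse)
  have "(\<Sum>p\<in>UNIV. (e $ fst p $ snd p) *\<^sub>R X (Inr (Inr p)) y)
      = (\<Sum>i\<in>UNIV. \<Sum>\<alpha>\<in>UNIV. (0, 0, (e $ i $ \<alpha>) *\<^sub>R axis i (axis \<alpha> 1)))"
  proof -
    have "X (Inr (Inr p)) y = (0, 0, axis (fst p) (axis (snd p) 1))" for p
      by (cases p) simp
    then show ?thesis
      by (simp add: sum.cartesian_product split_beta)
  qed
  also have "\<dots> = (0, 0, e)"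
    using matrix_axis_expansion[of "\<lambda>i \<alpha>. e $ i $ \<alpha>"]
    by (simp add: prod_eq_iff fst_sum snd_sum)
  finally show ?thesis by (simp add: e)
qed

text \<open>A function pulled back from the temporal base feels only the first component of
  \<open>X C\<close>, a coordinate vector or zero; the nonlinear connection does not enter.\<close>

lemma pd_lift_h:
  assumes "y \<in> W" "smooth_on S f"
  shows "frechet_derivative (\<lambda>y. f (fst y)) (at y) (X C y)
    = (case C of Inl \<gamma> \<Rightarrow> pd \<gamma> f (fst y) | _ \<Rightarrow> 0)"
proof -
  have "(f has_derivative frechet_derivative f (at (fst y))) (at (fst y))"
    using smooth_on_has_derivative[OF open_S assms(2)] assms(1) by auto
  then show ?thesis
    using frechet_derivative_compose_bounded_linear[OF bounded_linear_fst, of f y "X C y"]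
      has_derivative_linear linear_0
    by (fastforce simp: fst_frame pd_def differentiableI split: sum.splits)
qed

lemma pd_lift_g:
  assumes "y \<in> W" "smooth_on R f"
  shows "frechet_derivative (\<lambda>y. f (fst (snd y))) (at y) (X C y)
    = (case C of Inr (Inl k) \<Rightarrow> pd k f (fst (snd y)) | _ \<Rightarrow> 0)"
proof -
  have "(f has_derivative frechet_derivative f (at (fst (snd y)))) (at (fst (snd y)))"
    using smooth_on_has_derivative[OF open_R assms(2)] assms(1) by auto
  then show ?thesis
    using frechet_derivative_compose_bounded_linear[OF bounded_linear_fst_snd, of f y "X C y"]
      has_derivative_linear linear_0
    by (fastforce simp: fst_snd_frame pd_def differentiableI split: sum.splits)
qed

end

section \<open>Connection, curvature and Ricci components in one chart\<close>

locale edml_chart_connection = edml_chart S R h g U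
  for S :: "(real^'p::finite) set" and R :: "(real^'n::finite) set"
    and h :: "real^'p \<Rightarrow> real^'p^'p" and g :: "real^'n \<Rightarrow> real^'n^'n"
    and U :: "real^'p \<Rightarrow> real^'n \<Rightarrow> real^'p^'n" +
  fixes D :: "('p, 'n) jvec connection"
  assumes cartan: "cartan_connection_on h g U W D"
begin

lemma linear_connection: "linear_connection_on W D"
  using cartan unfolding cartan_connection_on_def by blast

lemma connection_frame:
  assumes "z \<in> W"
  shows "D (X B) (X A) z = (\<Sum>E\<in>UNIV. cartan_coef h g E A B z *\<^sub>R X E z)"
proof -
  obtain t x v where z: "z = (t, x, v)" by (cases z)
  \<comment> \<open>The vertical coefficients contain a Kronecker delta written as a conditional.
    Moving it out of scalar multiples and sums lets one of the two vertical sums collapse.\<close>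
  have if_scale: "(if P then a else 0) *\<^sub>R b = (if P then a *\<^sub>R b else 0)"
    for P a and b :: "('p, 'n) jvec"
    by simp
  have if_sum: "(\<Sum>\<alpha>\<in>UNIV. if P then f \<alpha> else 0) = (if P then \<Sum>\<alpha>\<in>UNIV. f \<alpha> else 0)"
    for P and f :: "'p \<Rightarrow> ('p, 'n) jvec"
    by simp
  note D = cartan[unfolded cartan_connection_on_def, THEN conjunct2, rule_format,
      OF assms[unfolded z]]
  show ?thesis
    using D unfolding z
    by (cases A rule: fidx_cases; cases B rule: fidx_cases)
      (simp_all add: sum_fidx if_distribR if_scale if_sum sum_negf del: frame.simps)
qed

lemma connection_vertical:
  assumes "z \<in> W"
  shows "D (X (Inr (Inr p))) (X A) z = 0"
  by (cases A rule: fidx_cases; cases p)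
    (simp_all add: connection_frame[OF assms] sum_fidx del: frame.simps)

text \<open>The connection is function-linear in its first argument, so its vanishing along vertical
  frame fields passes to their combinations. Such a combination equals the bracket on
  \<open>W\<close> only, hence \<open>connection_cong_left\<close>.\<close>

lemma connection_bracket_frame:
  assumes "y \<in> W"
  shows "D (lie_bracket (X C) (X B)) (X A) y = 0"
proof -
  let ?c = "\<lambda>p y. snd (snd (lie_bracket (X C) (X B) y)) $ fst p $ snd p"
  have b: "smooth_on W (lie_bracket (X C) (X B))"
    by (intro smooth_on_lie_bracket open_W smooth_frame)
  have c: "smooth_on W (?c p)" for p
    by (intro smooth_on_matrix_nth open_W smooth_on_bounded_linear[OF open_W _ b]
      bounded_linear_compose[OF bounded_linear_snd bounded_linear_snd])
  have s: "smooth_on W (\<lambda>z. ?c p z *\<^sub>R X (Inr (Inr p)) z)" for p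
    by (intro smooth_on_scaleR open_W smooth_frame c)
  have "D (lie_bracket (X C) (X B)) (X A) y
      = D (\<lambda>z. \<Sum>p\<in>UNIV. ?c p z *\<^sub>R X (Inr (Inr p)) z) (X A) y"
    by (intro connection_cong_left[OF open_W linear_connection] b smooth_on_sum open_W s
        smooth_frame assms lie_bracket_frame_vertical)
  also have "\<dots> = (\<Sum>p\<in>UNIV. D (\<lambda>z. ?c p z *\<^sub>R X (Inr (Inr p)) z) (X A) y)"
    by (intro connection_sum_left[OF open_W linear_connection] s smooth_frame assms finite)
  also have "\<dots> = (\<Sum>p\<in>UNIV. ?c p y *\<^sub>R D (X (Inr (Inr p))) (X A) y)"
    by (intro sum.cong refl connection_scale_left[OF open_W linear_connection] c smooth_frame assms)
  also have "\<dots> = 0"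
    by (simp add: connection_vertical[OF assms])
  finally show ?thesis .
qed

lemma curv_comp_frame:
  assumes "y \<in> W"
  shows "curv_comp h g U D y F A B C
    = frechet_derivative (cartan_coef h g F A B) (at y) (X C y)
      - frechet_derivative (cartan_coef h g F A C) (at y) (X B y)
      + (\<Sum>E\<in>UNIV. cartan_coef h g E A B y * cartan_coef h g F E C y)
      - (\<Sum>E\<in>UNIV. cartan_coef h g E A C y * cartan_coef h g F E B y)"
proof -
  have "curvature D (X C) (X B) (X A) y
    = (\<Sum>F\<in>UNIV. (frechet_derivative (cartan_coef h g F A B) (at y) (X C y)
      - frechet_derivative (cartan_coef h g F A C) (at y) (X B y)
      + (\<Sum>E\<in>UNIV. cartan_coef h g E A B y * cartan_coef h g F E C y)
      - (\<Sum>E\<in>UNIV. cartan_coef h g E A C y * cartan_coef h g F E B y)) *\<^sub>R X F y)"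
    by (rule curvature_frame[OF open_W linear_connection, where X = X])
      (simp_all add: smooth_frame smooth_cartan_coef connection_frame assms
        connection_bracket_frame del: frame.simps)
  then show ?thesis
    by (simp add: curv_comp_def linear_sum[OF linear_coframe] linear_scale[OF linear_coframe]
        coframe_frame if_distrib cong: if_cong)
qed

text \<open>In the trace the upper index is also the last lower one, and the coefficients preserve
  the type of an index. For vertical \<open>A\<close> the trace therefore runs over vertical
  directions, where all coefficients and derivatives vanish. In the other vanishing cases the only
  derivative left is that of a Christoffel symbol of one base in a direction foreign to it.\<close>

lemma ric_comp_frame:
  assumes "(t, x, v) \<in> W"
  shows "ric_comp h g U D (t, x, v) A B = (case (A, B) of
      (Inl \<alpha>, Inl \<beta>) \<Rightarrow> ricci h t \<alpha> \<beta>
    | (Inr (Inl i), Inr (Inl j)) \<Rightarrow> ricci g x i j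
    | _ \<Rightarrow> 0)"
proof -
  note h' = pd_lift_h[OF assms smooth_christoffel_h]
    pd_lift_h[OF assms smooth_on_minus[OF open_S smooth_christoffel_h]]
  note g' = pd_lift_g[OF assms smooth_christoffel_g]
  \<comment> \<open>The conditionals in \<open>cartan_coef\<close> choose between whole functions,
    so differentiation can be moved into their branches.\<close>
  show ?thesis
    unfolding ric_comp_def curv_comp_frame[OF assms]
    by (cases A rule: fidx_cases; cases B rule: fidx_cases)
      (simp_all add: sum_fidx h' g' frechet_derivative_const ricci_def riemann_def
        if_distrib[of "\<lambda>f. frechet_derivative f (at _)"] if_distribR del: frame.simps cong: if_cong)
qed

end

section \<open>Induced charts of the jet bundle\<close>

text \<open>The witness jet is that of the map which is affine in the two charts.\<close>

lemma jet_coords_image: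
  assumes AT: "smooth_atlas AT" and AM: "smooth_atlas AM" and c: "c \<in> AT" and d: "d \<in> AM"
  shows "jet_coords c d ` jet_dom AT AM c d = cimg c \<times> cimg d \<times> UNIV"
proof (intro equalityI subsetI)
  show "y \<in> cimg c \<times> cimg d \<times> UNIV" if "y \<in> jet_coords c d ` jet_dom AT AM c d" for y
    using that by (auto simp: jet_coords_def jet_dom_def)
next
  fix y assume "y \<in> cimg c \<times> cimg d \<times> (UNIV :: (real^'b^'d) set)"
  then obtain \<tau> x v where y: "y = (\<tau>, x, v)" and \<tau>: "\<tau> \<in> cimg c" and x: "x \<in> cimg d"
    by auto
  have oc: "open (cdom c)" "open (cimg c)" and hc: "homeomorphism (cdom c) (cimg c) (cmap c) (cinv c)"
    and od: "open (cimg d)" and hd: "homeomorphism (cdom d) (cimg d) (cmap d) (cinv d)"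
    using AT AM c d unfolding smooth_atlas_def by blast+
  define t where "t = cinv c \<tau>"
  have t: "t \<in> cdom c" "cmap c t = \<tau>"
    using \<tau> by (simp_all add: t_def inv_into_into f_inv_into_f)
  define A where "A z = x + v *v (z - \<tau>)" for z
  define \<phi> where "\<phi> s = cinv d (A (cmap c s))" for s
  \<comment> \<open>\<open>cinv d\<close> inverts the chart only on its image, so the construction
    is restricted to points whose affine image stays there.\<close>
  define V where "V = cimg c \<inter> A -` cimg d"
  define N where "N = cdom c \<inter> cmap c -` V"
  have A_der: "(A has_derivative (\<lambda>h. v *v h)) (at z)" for z
    unfolding A_def[abs_def]
    by (auto intro!: derivative_eq_intros
        bounded_linear.has_derivative[OF matrix_vector_mul_bounded_linear])
  have "continuous_on UNIV A"
    unfolding A_def[abs_def]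
    by (intro continuous_intros linear_continuous_on[OF matrix_vector_mul_bounded_linear,
          THEN continuous_on_compose2[of UNIV]]) auto
  then have V: "open V"
    unfolding V_def using oc(2) od by (intro open_Int) (auto intro: open_vimage)
  have N: "open N"
    unfolding N_def using hc oc(1) V by (intro continuous_open_preimage) (auto simp: homeomorphism_def)
  have NV: "cmap c ` N = V"
    by (auto simp: N_def V_def)
  have \<tau>V: "\<tau> \<in> V"
    using \<tau> x by (simp add: V_def A_def)
  have tN: "t \<in> N"
    using t \<tau>V by (simp add: N_def)
  have on_V: "(cmap d \<circ> \<phi> \<circ> cinv c) z = A z" if "z \<in> V" for z
    using that by (simp add: \<phi>_def V_def f_inv_into_f)
  have smooth_A: "smooth_on V A"
    unfolding A_def[abs_def]
    by (intro smooth_on_add V smooth_on_const smooth_on_bounded_linear[OF V matrix_vector_mul_bounded_linear]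
        smooth_on_diff smooth_on_id)
  have "smooth_on (cmap c ` N) (cmap d \<circ> \<phi> \<circ> cinv c)"
    unfolding NV by (rule smooth_on_cong[OF V _ smooth_A]) (rule on_V[symmetric])
  moreover have "\<phi> ` N \<subseteq> cdom d"
    by (auto simp: \<phi>_def N_def V_def inv_into_into)
  ultimately have near: "smooth_near AT AM t \<phi>"
    unfolding smooth_near_def using c d N tN N_def by blast
  define w where "w = jet1 AT AM t \<phi>"
  have \<phi>t: "\<phi> t \<in> cdom d" "cmap d (\<phi> t) = x"
    using x by (simp_all add: \<phi>_def t A_def inv_into_into f_inv_into_f)
  have "\<phi> \<in> snd w"
    using near by (simp add: w_def jet1_def)
  \<comment> \<open>The chosen representative may differ from \<open>\<phi>\<close>, but membership
    in the class fixes its value and its first derivatives in these charts.\<close>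
  then have "jet_rep w \<in> snd w"
    unfolding jet_rep_def by (rule someI[of "\<lambda>\<psi>. \<psi> \<in> snd w"])
  then have rep: "jet_rep w t = \<phi> t" "local_deriv c d t (jet_rep w) = local_deriv c d t \<phi>"
    using c d t \<phi>t by (auto simp: w_def jet1_def)
  have src: "jet_source w = t"
    by (simp add: w_def jet1_def jet_source_def)
  have "frechet_derivative (cmap d \<circ> \<phi> \<circ> cinv c) (at \<tau>) = frechet_derivative A (at \<tau>)"
    by (rule frechet_derivative_cong_open[OF V \<tau>V on_V])
  then have "local_deriv c d t \<phi> = v"
    by (simp add: local_deriv_def t frechet_derivative_eqI[OF A_der])
  then have "jet_coords c d w = y"
    by (simp add: jet_coords_def jet_target_def src rep t \<phi>t y)
  moreover have "w \<in> jet_dom AT AM c d"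
    using near by (auto simp: jet_dom_def J1_def w_def[symmetric] src t jet_target_def rep \<phi>t)
      (auto simp: w_def)
  ultimately show "y \<in> jet_coords c d ` jet_dom AT AM c d"
    by blast
qed

section \<open>The Einstein equations in the adapted frame\<close>

theorem theorem4p1:
  fixes AT :: "('t::{t2_space, second_countable_topology}, 'p::finite) chart set"
    and AM :: "('m::{t2_space, second_countable_topology}, 'n::finite) chart set"
    and h :: "('t, 'p) chart \<Rightarrow> real^'p \<Rightarrow> real^'p^'p"
    and g :: "('m, 'n) chart \<Rightarrow> real^'n \<Rightarrow> real^'n^'n"
    and U :: "('t, 'p) chart \<Rightarrow> ('m, 'n) chart \<Rightarrow> real^'p \<Rightarrow> real^'n \<Rightarrow> real^'p^'n"
    and F :: "'t \<Rightarrow> 'm \<Rightarrow> real"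
    and L :: "('t, 'm) jet \<Rightarrow> real"
    and D :: "('t, 'p) chart \<Rightarrow> ('m, 'n) chart \<Rightarrow> ('p, 'n) jvec connection"
    and \<T> :: "('t, 'p) chart \<Rightarrow> ('m, 'n) chart \<Rightarrow> ('p, 'n) jvec \<Rightarrow>
                ('p, 'n) jvec \<Rightarrow> ('p, 'n) jvec \<Rightarrow> real"
    and K :: real
  assumes "smooth_atlas AT" and "smooth_atlas AM"
    and "edml_space AT AM h g U F L"
    and "cartan_connection AT AM h g U D"
    and "jet_tensor2 AT AM \<T>"
    and "K \<noteq> 0"
    and "c \<in> AT" and "d \<in> AM" and "w \<in> jet_dom AT AM c d"
    and "jet_coords c d w = (t, x, v)"
  shows
    "let y = (t, x, v);
         \<T>\<T> = (\<lambda>A B. \<T> c d y (frame (h c) (g d) (U c d) A y) (frame (h c) (g d) (U c d) B y));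
         H = scalar_curv (h c) t;
         r = scalar_curv (g d) x
     in (\<forall>X Y. ric_tensor (h c) (g d) (U c d) (D c d) y X Y
               - sc_curv (h c) (g d) (U c d) (D c d) y / 2
                   * grav_potential (h c) (g d) (U c d) y X Y
             = K * \<T> c d y X Y)
        \<longleftrightarrow>
        (\<forall>\<alpha> \<beta>. ricci (h c) t \<alpha> \<beta> - (H + r) / 2 * h c t $ \<alpha> $ \<beta> = K * \<T>\<T> (tI \<alpha>) (tI \<beta>)) \<and>
        (\<forall>i j. ricci (g d) x i j - (H + r) / 2 * g d x $ i $ j = K * \<T>\<T> (xI i) (xI j)) \<and>
        (\<forall>\<alpha> \<beta> i j. - (H + r) / 2 * matrix_inv (h c t) $ \<alpha> $ \<beta> * g d x $ i $ j
             = K * \<T>\<T> (vI i \<alpha>) (vI j \<beta>)) \<and>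
        (\<forall>\<alpha> i. 0 = \<T>\<T> (tI \<alpha>) (xI i)) \<and>
        (\<forall>i \<alpha>. 0 = \<T>\<T> (xI i) (tI \<alpha>)) \<and>
        (\<forall>i \<alpha> \<beta>. 0 = \<T>\<T> (vI i \<alpha>) (tI \<beta>)) \<and>
        (\<forall>\<alpha> i \<beta>. 0 = \<T>\<T> (tI \<alpha>) (vI i \<beta>)) \<and>
        (\<forall>i j \<alpha>. 0 = \<T>\<T> (xI i) (vI j \<alpha>)) \<and>
        (\<forall>i \<alpha> j. 0 = \<T>\<T> (vI i \<alpha>) (xI j))"
proof -
  define y where "y = (t, x, v)"
  define \<T>\<T> where "\<T>\<T> = (\<lambda>A B. \<T> c d y (frame (h c) (g d) (U c d) A y) (frame (h c) (g d) (U c d) B y))"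
  define H where "H = scalar_curv (h c) t"
  define r where "r = scalar_curv (g d) x"
  let ?c = "\<lambda>A. coframe (h c) (g d) (U c d) A y"
    and ?e = "\<lambda>A. frame (h c) (g d) (U c d) A y"
  let ?R = "ric_comp (h c) (g d) (U c d) (D c d) y"
    and ?G = "block_metric (h c t) (g d x) (matrix_inv (h c t))"
  have atlas: "open (cimg c)" "open (cimg d)"
    using assms(1,2,7,8) unfolding smooth_atlas_def by blast+
  have metrics: "semi_riemannian_metric AT h" "semi_riemannian_metric AM g" "d_tensor_U AT AM U"
    using assms(3) unfolding edml_space_def by blast+
  have "y \<in> cimg c \<times> cimg d \<times> UNIV"
    using assms(9,10) jet_coords_image[OF assms(1,2,7,8)] unfolding y_def by (metis imageI)
  then have y: "(t, x, v) \<in> cimg c \<times> cimg d \<times> UNIV" and t: "t \<in> cimg c" and x: "x \<in> cimg d"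
    by (auto simp: y_def)
  interpret edml_chart_connection "cimg c" "cimg d" "h c" "g d" "U c d" "D c d"
  proof
    \<comment> \<open>The definition refers to the image of the jet chart domain;
      \<open>jet_coords_image\<close> identifies it with the open product \<open>W\<close>.\<close>
    show "cartan_connection_on (h c) (g d) (U c d) (cimg c \<times> cimg d \<times> UNIV) (D c d)"
      using assms(4,7,8) jet_coords_image[OF assms(1,2,7,8)] unfolding cartan_connection_def by metis
    show "smooth_on (cimg c) (h c)"
      using metrics(1) assms(7) unfolding semi_riemannian_metric_def by blast
    show "invertible (h c s)" if "s \<in> cimg c" for s
      using metrics(1) assms(7) that unfolding semi_riemannian_metric_def by blast
    show "smooth_on (cimg d) (g d)"
      using metrics(2) assms(8) unfolding semi_riemannian_metric_def by blast
    show "invertible (g d s)" if "s \<in> cimg d" for s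
      using metrics(2) assms(8) that unfolding semi_riemannian_metric_def by blast
    show "smooth_on (cimg c \<times> cimg d) (\<lambda>(t, x). U c d t x)"
      using metrics(3) assms(7,8) unfolding d_tensor_U_def by blast
  qed (use atlas in simp_all)
  \<comment> \<open>Stress-energy tensor and potential are brought to the form in which
    \<open>ric_tensor\<close> is defined: coefficients against products of coframe values.\<close>
  have T: "\<T> c d y X Y = (\<Sum>A\<in>UNIV. \<Sum>B\<in>UNIV. \<T>\<T> A B * ?c A X * ?c B Y)" for X Y
    unfolding \<T>\<T>_def using assms(5,7-10) unfolding jet_tensor2_def y_def
    by (intro bilinear_frame_expansion) metis
  have G: "grav_potential (h c) (g d) (U c d) y X Y
      = (\<Sum>A\<in>UNIV. \<Sum>B\<in>UNIV. ?G A B * ?c A X * ?c B Y)" for X Y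
    unfolding y_def by (rule grav_potential_block)
  have R: "?R A B = (case (A, B) of (Inl \<alpha>, Inl \<beta>) \<Rightarrow> ricci (h c) t \<alpha> \<beta>
      | (Inr (Inl i), Inr (Inl j)) \<Rightarrow> ricci (g d) x i j | _ \<Rightarrow> 0)" for A B
    unfolding y_def by (rule ric_comp_frame[OF y])
  \<comment> \<open>The vertical block of the inverse potential, which contains \<open>h\<close>,
    meets only zero Ricci components; the two base blocks give the traces \<open>H\<close> and
    \<open>r\<close>.\<close>
  have sc: "sc_curv (h c) (g d) (U c d) (D c d) y = H + r"
    unfolding sc_curv_def R unfolding y_def
    by (simp add: matrix_inv_G_mat[where h = "h c" and g = "g d", OF invertible_h[OF t]
          invertible_g[OF x]] sum_fidx H_def r_def scalar_curv_def)
  \<comment> \<open>Forwards, evaluate on frame vectors; backwards, multiply the component equations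
    by coframe values and sum.\<close>
  have "(\<forall>X Y. ric_tensor (h c) (g d) (U c d) (D c d) y X Y
        - (H + r) / 2 * grav_potential (h c) (g d) (U c d) y X Y = K * \<T> c d y X Y)
      \<longleftrightarrow> (\<forall>A B. ?R A B - (H + r) / 2 * ?G A B = K * \<T>\<T> A B)" (is "?lhs \<longleftrightarrow> ?rhs")
  proof
    assume ?lhs
    then have "ric_tensor (h c) (g d) (U c d) (D c d) y (?e A) (?e B)
        - (H + r) / 2 * grav_potential (h c) (g d) (U c d) y (?e A) (?e B)
        = K * \<T> c d y (?e A) (?e B)" for A B
      by blast
    then show ?rhs
      unfolding ric_tensor_def G T frame_form_frame by blast
  next
    assume ?rhs
    then have "(\<Sum>A\<in>UNIV. \<Sum>B\<in>UNIV. (?R A B - (H + r) / 2 * ?G A B) * ?c A X * ?c B Y)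
        = (\<Sum>A\<in>UNIV. \<Sum>B\<in>UNIV. K * \<T>\<T> A B * ?c A X * ?c B Y)" for X Y
      by simp
    then show ?lhs
      unfolding ric_tensor_def G T
      by (simp add: sum_distrib_left sum_subtractf left_diff_distrib mult.assoc)
  qed
  also have "\<dots> \<longleftrightarrow>
        (\<forall>\<alpha> \<beta>. ricci (h c) t \<alpha> \<beta> - (H + r) / 2 * h c t $ \<alpha> $ \<beta> = K * \<T>\<T> (tI \<alpha>) (tI \<beta>)) \<and>
        (\<forall>i j. ricci (g d) x i j - (H + r) / 2 * g d x $ i $ j = K * \<T>\<T> (xI i) (xI j)) \<and>
        (\<forall>\<alpha> \<beta> i j. - (H + r) / 2 * matrix_inv (h c t) $ \<alpha> $ \<beta> * g d x $ i $ j
             = K * \<T>\<T> (vI i \<alpha>) (vI j \<beta>)) \<and>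
        (\<forall>\<alpha> i. 0 = \<T>\<T> (tI \<alpha>) (xI i)) \<and>
        (\<forall>i \<alpha>. 0 = \<T>\<T> (xI i) (tI \<alpha>)) \<and>
        (\<forall>i \<alpha> \<beta>. 0 = \<T>\<T> (vI i \<alpha>) (tI \<beta>)) \<and>
        (\<forall>\<alpha> i \<beta>. 0 = \<T>\<T> (tI \<alpha>) (vI i \<beta>)) \<and>
        (\<forall>i j \<alpha>. 0 = \<T>\<T> (xI i) (vI j \<alpha>)) \<and>
        (\<forall>i \<alpha> j. 0 = \<T>\<T> (vI i \<alpha>) (xI j))"
  proof -
    \<comment> \<open>In the mixed blocks both Ricci tensor and potential vanish; cancelling the
      nonzero constant \<open>K\<close> leaves the vanishing of the stress-energy component.\<close>
    have zero: "0 - (H + r) / 2 * 0 = K * a \<longleftrightarrow> 0 = a" for a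
      using assms(6) by simp
    have vert: "0 - (H + r) / 2 * (a * b) = - (H + r) / 2 * a * b" for a b
      by (simp add: field_simps)
    \<comment> \<open>Splitting both indices by type gives nine blocks; after simplification the two
      sides differ only in the order of conjuncts and quantifiers.\<close>
    show ?thesis
      unfolding all_fidx R
      by (simp only: prod.case sum.case block_metric.simps zero vert)
        (rule iffI; (elim conjE; intro conjI allI; simp only:))
  qed
  finally show ?thesis
    unfolding Let_def y_def[symmetric] sc H_def r_def \<T>\<T>_def .
qed

end
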